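(* Let $(M,g)$ be a four-dimensional Einstein pseudo-Riemannian manifold of neutral signature $(2,2)$ with non-zero scalar curvature. Then $(M,g)$ is semi-symmetric if and only if it is locally symmetric.
   Context: A pseudo-Riemannian manifold $(M,g)$ with Levi-Civita connection $\nabla$ and curvature tensor $R$ is called semi-symmetric if $R\cdot R=0$, i.e. $[R(X,Y),R(Z,T)]=R(R(X,Y)Z,T)+R(Z,R(X,Y)T)$ for all vector fields $X,Y,Z,T$. It is locally symmetric if $\nabla R=0$. It is Einstein if its Ricci operator is $\lambda\,\mathrm{Id}$ for a constant $\lambda\in\mathbb{R}$. A four-dimensional neutral manifold is one whose metric has signature $(2,2)$. *)

theory Defs
  imports "HOL-Analysis.Analysis"
begin

section \<open>Smooth maps and smooth manifolds\<close>

primrec Ck_on :: "nat \<Rightarrow> 'a::real_normed_vector set \<Rightarrow> ('a \<Rightarrow> 'b::real_normed_vector) \<Rightarrow> bool" where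
  "Ck_on 0 S f \<longleftrightarrow> continuous_on S f"
| "Ck_on (Suc k) S f \<longleftrightarrow>
     (\<forall>x\<in>S. f differentiable (at x)) \<and> (\<forall>v. Ck_on k S (\<lambda>x. frechet_derivative f (at x) v))"

text \<open>Only used for open \<open>S\<close>; the values of \<open>f\<close> outside \<open>S\<close> are then irrelevant.\<close>

definition smooth_on :: "'a::real_normed_vector set \<Rightarrow> ('a \<Rightarrow> 'b::real_normed_vector) \<Rightarrow> bool" where
  "smooth_on S f \<longleftrightarrow> (\<forall>k. Ck_on k S f)"

text \<open>A chart is a pair of its domain and the coordinate map; the latter is irrelevant outside the
  domain.\<close>

type_synonym ('m, 'n) chart = "'m set \<times> ('m \<Rightarrow> real ^ 'n)"

abbreviation chart_dom :: "('m, 'n::finite) chart \<Rightarrow> 'm set" where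
  "chart_dom c \<equiv> fst c"

abbreviation chart_map :: "('m, 'n::finite) chart \<Rightarrow> 'm \<Rightarrow> real ^ 'n" where
  "chart_map c \<equiv> snd c"

definition chart_image :: "('m, 'n::finite) chart \<Rightarrow> (real ^ 'n) set" where
  "chart_image c = chart_map c ` chart_dom c"

definition overlap :: "('m, 'n::finite) chart \<Rightarrow> ('m, 'n) chart \<Rightarrow> (real ^ 'n) set" where
  "overlap c d = chart_map c ` (chart_dom c \<inter> chart_dom d)"

definition transition :: "('m, 'n::finite) chart \<Rightarrow> ('m, 'n) chart \<Rightarrow> real ^ 'n \<Rightarrow> real ^ 'n" where
  "transition c d = chart_map d \<circ> inv_into (chart_dom c) (chart_map c)"

definition smooth_manifold :: "'m topology \<Rightarrow> ('m, 'n::finite) chart set \<Rightarrow> bool" where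
  "smooth_manifold M A \<longleftrightarrow>
     Hausdorff_space M \<and> second_countable M \<and>
     (\<Union>c\<in>A. chart_dom c) = topspace M \<and>
     (\<forall>c\<in>A. openin M (chart_dom c) \<and> open (chart_image c) \<and>
        homeomorphic_map (subtopology M (chart_dom c)) (top_of_set (chart_image c)) (chart_map c)) \<and>
     (\<forall>c\<in>A. \<forall>d\<in>A. smooth_on (overlap c d) (transition c d))"

section \<open>Pseudo-Riemannian metrics\<close>

definition bilin :: "real ^ 'n ^ 'n \<Rightarrow> real ^ 'n::finite \<Rightarrow> real ^ 'n \<Rightarrow> real" where
  "bilin B u v = u \<bullet> (B *v v)"

text \<open>Signature \<open>(p, q)\<close>, witnessed by a pseudo-orthonormal family indexed by the dimension. Such a
  family is automatically a basis, so \<open>B\<close> is nondegenerate.\<close>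

definition has_signature :: "real ^ 'n ^ 'n::finite \<Rightarrow> nat \<Rightarrow> nat \<Rightarrow> bool" where
  "has_signature B p q \<longleftrightarrow> transpose B = B \<and>
     (\<exists>e :: 'n \<Rightarrow> real ^ 'n.
        (\<forall>i j. i \<noteq> j \<longrightarrow> bilin B (e i) (e j) = 0) \<and>
        (\<forall>i. bilin B (e i) (e i) = 1 \<or> bilin B (e i) (e i) = -1) \<and>
        card {i. bilin B (e i) (e i) = 1} = p \<and>
        card {i. bilin B (e i) (e i) = -1} = q)"

text \<open>The metric is given by its coordinate matrices: \<open>g c x\<close> is the Gram matrix of the coordinate
  vector fields of the chart \<open>c\<close> at the point with coordinates \<open>x\<close>. The last condition is the
  transformation law of a covariant 2-tensor.\<close>

definition pseudo_riemannian_metric ::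
  "('m, 'n::finite) chart set \<Rightarrow> (('m, 'n) chart \<Rightarrow> real ^ 'n \<Rightarrow> real ^ 'n ^ 'n) \<Rightarrow> nat \<Rightarrow> nat \<Rightarrow> bool" where
  "pseudo_riemannian_metric A g p q \<longleftrightarrow>
     (\<forall>c\<in>A. smooth_on (chart_image c) (g c)) \<and>
     (\<forall>c\<in>A. \<forall>x\<in>chart_image c. has_signature (g c x) p q) \<and>
     (\<forall>c\<in>A. \<forall>d\<in>A. \<forall>x\<in>overlap c d. \<forall>u v.
        bilin (g c x) u v =
        bilin (g d (transition c d x))
          (frechet_derivative (transition c d) (at x) u)
          (frechet_derivative (transition c d) (at x) v))"

definition pseudo_riemannian_manifold ::
  "'m topology \<Rightarrow> ('m, 'n::finite) chart set \<Rightarrow> (('m, 'n) chart \<Rightarrow> real ^ 'n \<Rightarrow> real ^ 'n ^ 'n) \<Rightarrow>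
   nat \<Rightarrow> nat \<Rightarrow> bool" where
  "pseudo_riemannian_manifold M A g p q \<longleftrightarrow> smooth_manifold M A \<and> pseudo_riemannian_metric A g p q"

section \<open>Levi-Civita connection and curvature in a chart\<close>

text \<open>In this section \<open>G\<close> is the coordinate matrix of the metric in one chart, and vector fields on
  the chart domain are given by their coordinate representations.\<close>

type_synonym 'n vfield = "real ^ 'n \<Rightarrow> real ^ 'n"

definition partial_metric :: "(real ^ 'n \<Rightarrow> real ^ 'n ^ 'n) \<Rightarrow> real ^ 'n \<Rightarrow> 'n::finite \<Rightarrow> 'n \<Rightarrow> 'n \<Rightarrow> real" where
  "partial_metric G x i j l = frechet_derivative G (at x) (axis i 1) $ j $ l"

text \<open>\<open>christoffel G x k i j\<close> is the symbol with upper index \<open>k\<close> and lower indices \<open>i\<close>, \<open>j\<close>.\<close>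

definition christoffel :: "(real ^ 'n \<Rightarrow> real ^ 'n ^ 'n) \<Rightarrow> real ^ 'n \<Rightarrow> 'n::finite \<Rightarrow> 'n \<Rightarrow> 'n \<Rightarrow> real" where
  "christoffel G x k i j = (1/2) * (\<Sum>l\<in>UNIV. matrix_inv (G x) $ k $ l *
     (partial_metric G x i j l + partial_metric G x j i l - partial_metric G x l i j))"

text \<open>\<open>levi_civita G X Y\<close> is the covariant derivative of \<open>Y\<close> along \<open>X\<close>. That it is torsion-free and
  metric is proved below.\<close>

definition levi_civita :: "(real ^ 'n \<Rightarrow> real ^ 'n ^ 'n) \<Rightarrow> 'n::finite vfield \<Rightarrow> 'n vfield \<Rightarrow> 'n vfield" where
  "levi_civita G X Y = (\<lambda>x. frechet_derivative Y (at x) (X x) +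
     (\<chi> k. \<Sum>i\<in>UNIV. \<Sum>j\<in>UNIV. christoffel G x k i j * X x $ i * Y x $ j))"

definition lie_bracket :: "'n::finite vfield \<Rightarrow> 'n vfield \<Rightarrow> 'n vfield" where
  "lie_bracket X Y = (\<lambda>x. frechet_derivative Y (at x) (X x) - frechet_derivative X (at x) (Y x))"

definition curvature ::
  "(real ^ 'n \<Rightarrow> real ^ 'n ^ 'n) \<Rightarrow> 'n::finite vfield \<Rightarrow> 'n vfield \<Rightarrow> 'n vfield \<Rightarrow> 'n vfield" where
  "curvature G X Y Z = (\<lambda>x. levi_civita G X (levi_civita G Y Z) x
     - levi_civita G Y (levi_civita G X Z) x - levi_civita G (lie_bracket X Y) Z x)"

text \<open>The covariant derivative of the curvature tensor along \<open>V\<close>, applied to \<open>X\<close>, \<open>Y\<close>, \<open>Z\<close>.\<close>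

definition nabla_curvature ::
  "(real ^ 'n \<Rightarrow> real ^ 'n ^ 'n) \<Rightarrow> 'n::finite vfield \<Rightarrow> 'n vfield \<Rightarrow> 'n vfield \<Rightarrow> 'n vfield \<Rightarrow> 'n vfield" where
  "nabla_curvature G V X Y Z = (\<lambda>x. levi_civita G V (curvature G X Y Z) x
     - curvature G (levi_civita G V X) Y Z x
     - curvature G X (levi_civita G V Y) Z x
     - curvature G X Y (levi_civita G V Z) x)"

definition coord_field :: "'n::finite \<Rightarrow> 'n vfield" where
  "coord_field i = (\<lambda>x. axis i 1)"

text \<open>The Ricci tensor is the trace of \<open>X \<mapsto> R(X, Y) Z\<close>; it is obtained here as a matrix in
  coordinates, and the Ricci operator by raising an index.\<close>

definition ricci :: "(real ^ 'n \<Rightarrow> real ^ 'n ^ 'n) \<Rightarrow> real ^ 'n \<Rightarrow> real ^ 'n ^ 'n::finite" where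
  "ricci G x = (\<chi> i j. \<Sum>k\<in>UNIV. curvature G (coord_field k) (coord_field i) (coord_field j) x $ k)"

definition ricci_operator :: "(real ^ 'n \<Rightarrow> real ^ 'n ^ 'n) \<Rightarrow> real ^ 'n \<Rightarrow> real ^ 'n ^ 'n::finite" where
  "ricci_operator G x = matrix_inv (G x) ** ricci G x"

definition scalar_curvature :: "(real ^ 'n \<Rightarrow> real ^ 'n ^ 'n) \<Rightarrow> real ^ 'n::finite \<Rightarrow> real" where
  "scalar_curvature G x = trace (ricci_operator G x)"

section \<open>Curvature conditions on the manifold\<close>

definition einstein ::
  "('m, 'n::finite) chart set \<Rightarrow> (('m, 'n) chart \<Rightarrow> real ^ 'n \<Rightarrow> real ^ 'n ^ 'n) \<Rightarrow> bool" where
  "einstein A g \<longleftrightarrow>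
     (\<exists>r::real. \<forall>c\<in>A. \<forall>x\<in>chart_image c. ricci_operator (g c) x = mat r)"

text \<open>Identities between tensor fields are local, so they are required on every chart domain, for all
  smooth vector fields there. In \<open>semi_symmetric\<close> the identity
  \<open>[R(X, Y), R(Z, T)] = R(R(X, Y) Z, T) + R(Z, R(X, Y) T)\<close> of endomorphism fields is evaluated on a
  vector field \<open>W\<close>.\<close>

definition semi_symmetric ::
  "('m, 'n::finite) chart set \<Rightarrow> (('m, 'n) chart \<Rightarrow> real ^ 'n \<Rightarrow> real ^ 'n ^ 'n) \<Rightarrow> bool" where
  "semi_symmetric A g \<longleftrightarrow>
     (\<forall>c\<in>A. \<forall>X Y Z T W.
        smooth_on (chart_image c) X \<and> smooth_on (chart_image c) Y \<and> smooth_on (chart_image c) Z \<and>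
        smooth_on (chart_image c) T \<and> smooth_on (chart_image c) W \<longrightarrow>
        (let R = curvature (g c) in \<forall>x\<in>chart_image c.
           R X Y (R Z T W) x - R Z T (R X Y W) x = R (R X Y Z) T W x + R Z (R X Y T) W x))"

definition locally_symmetric ::
  "('m, 'n::finite) chart set \<Rightarrow> (('m, 'n) chart \<Rightarrow> real ^ 'n \<Rightarrow> real ^ 'n ^ 'n) \<Rightarrow> bool" where
  "locally_symmetric A g \<longleftrightarrow>
     (\<forall>c\<in>A. \<forall>V X Y Z.
        smooth_on (chart_image c) V \<and> smooth_on (chart_image c) X \<and>
        smooth_on (chart_image c) Y \<and> smooth_on (chart_image c) Z \<longrightarrow>
        (\<forall>x\<in>chart_image c. nabla_curvature (g c) V X Y Z x = 0))"

section \<open>The connection is torsion-free and metric\<close>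

lemma has_signature_invertible:
  fixes B :: "real ^ 'n ^ 'n::finite"
  assumes "has_signature B p q"
  shows "invertible B"
proof -
  obtain e :: "'n \<Rightarrow> real ^ 'n" where
    o: "\<And>i j. i \<noteq> j \<Longrightarrow> bilin B (e i) (e j) = 0" and
    n: "\<And>i. bilin B (e i) (e i) = 1 \<or> bilin B (e i) (e i) = -1"
    using assms unfolding has_signature_def by (elim conjE exE) auto
  define P where "P = (\<chi> i. e i)"
  define D where "D = P ** B ** transpose P"
  have D: "D $ i $ j = bilin B (e i) (e j)" for i j
  proof -
    have "D $ i $ j = (\<Sum>k\<in>UNIV. (\<Sum>l\<in>UNIV. e i $ l * B $ l $ k) * e j $ k)"
      by (simp add: D_def P_def matrix_matrix_mult_def transpose_def)
    also have "\<dots> = (\<Sum>l\<in>UNIV. \<Sum>k\<in>UNIV. e i $ l * B $ l $ k * e j $ k)"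
      by (subst sum.swap) (simp add: sum_distrib_right)
    also have "\<dots> = bilin B (e i) (e j)"
      by (simp add: bilin_def inner_vec_def matrix_vector_mult_def sum_distrib_left mult.assoc)
    finally show ?thesis .
  qed
  have "det D = (\<Prod>i\<in>UNIV. D $ i $ i)"
    by (rule det_diagonal) (simp add: D o)
  moreover have "D $ i $ i \<noteq> 0" for i
    using n[of i] by (auto simp: D)
  ultimately have "det D \<noteq> 0" by simp
  then have "det B \<noteq> 0"
    by (auto simp: D_def det_mul)
  then show ?thesis by (simp add: invertible_det_nz)
qed

lemma partial_metric_sym:
  assumes "open S" "x \<in> S" "G differentiable (at x)" "\<And>y. y \<in> S \<Longrightarrow> transpose (G y) = G y"
  shows "partial_metric G x i j l = partial_metric G x i l j"
proof -
  have d: "(G has_derivative frechet_derivative G (at x)) (at x)"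
    using assms(3) by (simp add: frechet_derivative_works)
  have c: "((\<lambda>y. G y $ a $ b) has_derivative (\<lambda>h. frechet_derivative G (at x) h $ a $ b)) (at x)" for a b
    by (intro bounded_linear.has_derivative[OF bounded_linear_vec_nth] d)
  have "((\<lambda>y. G y $ j $ l) has_derivative (\<lambda>h. frechet_derivative G (at x) h $ l $ j)) (at x)"
  proof (rule has_derivative_transform_within_open[OF c[of l j] assms(1,2)])
    fix y assume "y \<in> S"
    then show "G y $ l $ j = G y $ j $ l"
      using arg_cong[OF assms(4)[of y], of "\<lambda>B. B $ l $ j"] by (simp add: transpose_def)
  qed
  from fun_cong[OF has_derivative_unique[OF c[of j l] this], of "axis i 1"] show ?thesis
    unfolding partial_metric_def .
qed

lemma christoffel_sym:
  assumes "open S" "x \<in> S" "G differentiable (at x)" "\<And>y. y \<in> S \<Longrightarrow> transpose (G y) = G y"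
  shows "christoffel G x k i j = christoffel G x k j i"
  unfolding christoffel_def using partial_metric_sym[OF assms]
  by (simp add: add.commute)

lemma levi_civita_torsion_free:
  assumes "open S" "x \<in> S" "G differentiable (at x)" "\<And>y. y \<in> S \<Longrightarrow> transpose (G y) = G y"
  shows "levi_civita G X Y x - levi_civita G Y X x = lie_bracket X Y x"
proof -
  have "(\<Sum>i\<in>UNIV. \<Sum>j\<in>UNIV. christoffel G x k i j * X x $ i * Y x $ j) =
        (\<Sum>i\<in>UNIV. \<Sum>j\<in>UNIV. christoffel G x k i j * Y x $ i * X x $ j)" for k
    by (subst sum.swap) (intro sum.cong refl, simp add: christoffel_sym[OF assms, of k] mult_ac)
  then show ?thesis
    by (simp add: levi_civita_def lie_bracket_def)
qed

lemma christoffel_lowered: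
  assumes "invertible (G x)"
  shows "(\<Sum>k\<in>UNIV. G x $ m $ k * christoffel G x k i j) =
    (1/2) * (partial_metric G x i j m + partial_metric G x j i m - partial_metric G x m i j)"
proof -
  define w where "w = (\<chi> l. partial_metric G x i j l + partial_metric G x j i l - partial_metric G x l i j)"
  have c: "christoffel G x k i j = (1/2) * (matrix_inv (G x) *v w) $ k" for k
    by (simp add: christoffel_def w_def matrix_vector_mult_def)
  have "(\<Sum>k\<in>UNIV. G x $ m $ k * christoffel G x k i j) = (1/2) * (G x *v (matrix_inv (G x) *v w)) $ m"
    by (simp add: c matrix_vector_mult_def sum_distrib_left mult_ac)
  also have "G x *v (matrix_inv (G x) *v w) = w"
    using someI_ex[OF assms[unfolded invertible_def], folded matrix_inv_def]
    by (simp add: matrix_vector_mul_assoc)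
  finally show ?thesis by (simp add: w_def)
qed

lemma levi_civita_metric:
  fixes G :: "real ^ 'n \<Rightarrow> real ^ 'n ^ 'n::finite"
  assumes "open S" "x \<in> S" "G differentiable (at x)" "\<And>y. y \<in> S \<Longrightarrow> transpose (G y) = G y"
    and inv: "invertible (G x)"
    and Y: "Y differentiable (at x)" and Z: "Z differentiable (at x)"
  shows "frechet_derivative (\<lambda>y. bilin (G y) (Y y) (Z y)) (at x) (X x) =
    bilin (G x) (levi_civita G X Y x) (Z x) + bilin (G x) (Y x) (levi_civita G X Z x)"
proof -
  let ?DG = "frechet_derivative G (at x)" and ?DY = "frechet_derivative Y (at x)"
    and ?DZ = "frechet_derivative Z (at x)"
  have comp: "bilin B u v = (\<Sum>j\<in>UNIV. \<Sum>m\<in>UNIV. u $ j * B $ j $ m * v $ m)"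
    for B :: "real ^ 'n ^ 'n" and u v :: "real ^ 'n"
    by (simp add: bilin_def inner_vec_def matrix_vector_mult_def sum_distrib_left mult.assoc)
  have dG: "((\<lambda>y. G y $ a $ b) has_derivative (\<lambda>h. ?DG h $ a $ b)) (at x)" for a b
    using assms(3)
    by (intro bounded_linear.has_derivative[OF bounded_linear_vec_nth]) (simp add: frechet_derivative_works)
  have dY: "((\<lambda>y. Y y $ a) has_derivative (\<lambda>h. ?DY h $ a)) (at x)" for a
    using Y
    by (intro bounded_linear.has_derivative[OF bounded_linear_vec_nth]) (simp add: frechet_derivative_works)
  have dZ: "((\<lambda>y. Z y $ a) has_derivative (\<lambda>h. ?DZ h $ a)) (at x)" for a
    using Z
    by (intro bounded_linear.has_derivative[OF bounded_linear_vec_nth]) (simp add: frechet_derivative_works)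
  have dterm: "((\<lambda>y. Y y $ j * G y $ j $ m * Z y $ m) has_derivative
     (\<lambda>h. ?DY h $ j * G x $ j $ m * Z x $ m + Y x $ j * ?DG h $ j $ m * Z x $ m
        + Y x $ j * G x $ j $ m * ?DZ h $ m)) (at x)" for j m
    by (rule has_derivative_eq_rhs[OF has_derivative_mult[OF has_derivative_mult[OF dY dG] dZ]])
      (simp add: fun_eq_iff algebra_simps)
  have "((\<lambda>y. bilin (G y) (Y y) (Z y)) has_derivative
     (\<lambda>h. bilin (G x) (?DY h) (Z x) + bilin (?DG h) (Y x) (Z x) + bilin (G x) (Y x) (?DZ h))) (at x)"
    unfolding comp sum.distrib[symmetric] by (intro has_derivative_sum dterm)
  then have fd: "frechet_derivative (\<lambda>y. bilin (G y) (Y y) (Z y)) (at x) (X x) =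
     bilin (G x) (?DY (X x)) (Z x) + bilin (?DG (X x)) (Y x) (Z x) + bilin (G x) (Y x) (?DZ (X x))"
    by (simp add: frechet_derivative_at[symmetric])
  have lin: "linear ?DG"
    using assms(3) by (rule linear_frechet_derivative)
  have DG: "?DG (X x) $ j $ m = (\<Sum>i\<in>UNIV. X x $ i * partial_metric G x i j m)" for j m
  proof -
    have "?DG (X x) = ?DG (\<Sum>i\<in>UNIV. X x $ i *\<^sub>R axis i 1)"
      using basis_expansion[of "X x"] by (simp add: scalar_mult_eq_scaleR)
    also have "\<dots> = (\<Sum>i\<in>UNIV. X x $ i *\<^sub>R ?DG (axis i 1))"
      by (simp add: linear_sum[OF lin] linear_scale[OF lin])
    finally show ?thesis by (simp add: partial_metric_def)
  qed
  define \<Gamma> where "\<Gamma> W = (\<chi> k. \<Sum>i\<in>UNIV. \<Sum>j\<in>UNIV. christoffel G x k i j * X x $ i * W $ j)"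
    for W :: "real ^ 'n"
  define L where "L m i j = (1/2) * (partial_metric G x i j m + partial_metric G x j i m
      - partial_metric G x m i j)" for m i j
  have low: "(G x *v \<Gamma> W) $ m = (\<Sum>i\<in>UNIV. \<Sum>j\<in>UNIV. L m i j * X x $ i * W $ j)" for W m
  proof -
    have "(G x *v \<Gamma> W) $ m =
      (\<Sum>k\<in>UNIV. \<Sum>i\<in>UNIV. \<Sum>j\<in>UNIV. G x $ m $ k * christoffel G x k i j * (X x $ i * W $ j))"
      by (simp add: matrix_vector_mult_def \<Gamma>_def sum_distrib_left mult_ac)
    also have "\<dots> = (\<Sum>i\<in>UNIV. \<Sum>k\<in>UNIV. \<Sum>j\<in>UNIV. G x $ m $ k * christoffel G x k i j * (X x $ i * W $ j))"
      by (rule sum.swap)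
    also have "\<dots> = (\<Sum>i\<in>UNIV. \<Sum>j\<in>UNIV. \<Sum>k\<in>UNIV. G x $ m $ k * christoffel G x k i j * (X x $ i * W $ j))"
      by (intro sum.cong refl sum.swap)
    also have "\<dots> = (\<Sum>i\<in>UNIV. \<Sum>j\<in>UNIV. L m i j * (X x $ i * W $ j))"
      unfolding L_def christoffel_lowered[of G x m, OF inv, symmetric]
      by (simp only: sum_distrib_right)
    finally show ?thesis by (simp add: mult.assoc)
  qed
  have symB: "bilin (G x) u v = bilin (G x) v u" for u v
  proof -
    have "v v* G x = G x *v v"
      using transpose_matrix_vector[of "G x" v] assms(4)[OF assms(2)] by simp
    then show ?thesis
      unfolding bilin_def using dot_lmul_matrix[of v "G x" u] by (simp add: inner_commute)
  qed
  have split: "L j i m + L m i j = partial_metric G x i j m" for i j m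
    unfolding L_def using partial_metric_sym[OF assms(1-4)] by (simp add: field_simps)
  have "bilin (G x) (\<Gamma> (Y x)) (Z x) + bilin (G x) (Y x) (\<Gamma> (Z x)) =
     (\<Sum>m\<in>UNIV. Z x $ m * (\<Sum>i\<in>UNIV. \<Sum>j\<in>UNIV. L m i j * X x $ i * Y x $ j)) +
     (\<Sum>j\<in>UNIV. Y x $ j * (\<Sum>i\<in>UNIV. \<Sum>m\<in>UNIV. L j i m * X x $ i * Z x $ m))"
    by (subst symB) (simp add: bilin_def inner_vec_def low)
  also have "(\<Sum>m\<in>UNIV. Z x $ m * (\<Sum>i\<in>UNIV. \<Sum>j\<in>UNIV. L m i j * X x $ i * Y x $ j)) =
     (\<Sum>m\<in>UNIV. \<Sum>j\<in>UNIV. \<Sum>i\<in>UNIV. Z x $ m * (L m i j * X x $ i * Y x $ j))"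
    unfolding sum_distrib_left by (intro sum.cong refl sum.swap)
  also have "\<dots> = (\<Sum>j\<in>UNIV. \<Sum>m\<in>UNIV. \<Sum>i\<in>UNIV. Z x $ m * (L m i j * X x $ i * Y x $ j))"
    by (rule sum.swap)
  also have "(\<Sum>j\<in>UNIV. Y x $ j * (\<Sum>i\<in>UNIV. \<Sum>m\<in>UNIV. L j i m * X x $ i * Z x $ m)) =
     (\<Sum>j\<in>UNIV. \<Sum>m\<in>UNIV. \<Sum>i\<in>UNIV. Y x $ j * (L j i m * X x $ i * Z x $ m))"
    unfolding sum_distrib_left by (intro sum.cong refl sum.swap)
  also have "(\<Sum>j\<in>UNIV. \<Sum>m\<in>UNIV. \<Sum>i\<in>UNIV. Z x $ m * (L m i j * X x $ i * Y x $ j)) + \<dots> =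
     bilin (?DG (X x)) (Y x) (Z x)"
    unfolding comp DG split[symmetric]
    by (simp add: sum.distrib sum_distrib_left sum_distrib_right algebra_simps)
  finally have key: "bilin (?DG (X x)) (Y x) (Z x) =
     bilin (G x) (\<Gamma> (Y x)) (Z x) + bilin (G x) (Y x) (\<Gamma> (Z x))" by simp
  have "levi_civita G X Y x = ?DY (X x) + \<Gamma> (Y x)" "levi_civita G X Z x = ?DZ (X x) + \<Gamma> (Z x)"
    by (simp_all add: levi_civita_def \<Gamma>_def)
  then show ?thesis
    unfolding fd key
    by (simp add: bilin_def inner_add_left inner_add_right matrix_vector_right_distrib)
qed

end

theory Submission
  imports Defs
begin

text \<open>In signature \<open>(2, 2)\<close> the bivectors split into self-dual and anti-self-dual parts, each a copy of
  \<open>sl(2, R)\<close>. The curvature operator of an Einstein metric preserves the splitting and both blocks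
  \<open>\<rho>\<close> have the same trace \<open>\<tau> \<noteq> 0\<close>. Semi-symmetry says \<open>[\<rho> u, \<rho> v] = \<rho> [\<rho> u, v]\<close> in each block; its
  antisymmetric part is \<open>3 \<rho>\<^sup>2 - 3 \<tau> \<rho> + 2 \<sigma> = 0\<close> with \<open>\<sigma>\<close> the second elementary symmetric function, and
  Cayley-Hamilton leaves \<open>\<rho> = \<tau>/3\<close> or \<open>\<rho>\<close> equal to \<open>\<tau>\<close> times the projection to a non-null vector. Applying
  \<open>\<nabla>\<close> to the quadratic identity kills \<open>\<nabla>\<rho>\<close> in the first case. In the second it gives
  \<open>\<nabla>\<rho> = v \<otimes> w + w \<otimes> v\<close> with \<open>w\<close> orthogonal to \<open>v\<close>, and the second Bianchi identity says that the
  invertible endomorphism belonging to the bivector \<open>v\<close> annihilates \<open>w\<close>. The converse is the Ricci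
  identity.\<close>

section \<open>Calculus of smooth maps\<close>

text \<open>In indefinite signature a self-adjoint \<open>\<rho>\<close> need not be diagonalisable,
  and no smooth eigenvector field is at hand. The proof therefore works with polynomial identities
  in \<open>\<rho>\<close>, which can be differentiated as tensors and then compared in a frame at
  one point. The quadratic identity rests on two facts about the bracket of a block, a
  three-dimensional cross product up to scale: for self-adjoint \<open>\<rho>\<close>,
  \<open>[\<rho> u, \<rho> v] = adj \<rho> [u, v]\<close> and
  \<open>[\<rho> u, v] + [u, \<rho> v] = (\<tau> - \<rho>) [u, v]\<close>. Antisymmetrising
  semi-symmetry thus gives \<open>2 adj \<rho> = \<rho> (\<tau> - \<rho>)\<close>, and
  \<open>adj \<rho> = \<rho>\<^sup>2 - \<tau> \<rho> + \<sigma>\<close> by Cayley-Hamilton. Together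
  they say that \<open>adj \<rho>\<close> is the scalar \<open>\<sigma>/3\<close>. If it is nonzero,
  \<open>\<rho>\<close> is scalar as well. If it is zero, all minors of order two vanish and
  \<open>\<rho>\<close> has rank at most one; here \<open>\<tau> \<noteq> 0\<close> excludes a
  nilpotent \<open>\<rho>\<close>, so that the vector spanning its image is non-null.\<close>

abbreviation dir_deriv :: "'a::real_normed_vector \<Rightarrow> ('a \<Rightarrow> 'b::real_normed_vector) \<Rightarrow> 'a \<Rightarrow> 'b" where
  "dir_deriv v f \<equiv> \<lambda>x. frechet_derivative f (at x) v"

lemma dir_deriv_eq:
  assumes "(f has_derivative f') (at x)"
  shows "dir_deriv v f x = f' v"
  using frechet_derivative_at[OF assms] by simp

lemma dir_deriv_cong:
  assumes "open S" "x \<in> S" "\<And>y. y \<in> S \<Longrightarrow> f y = g y"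
  shows "dir_deriv v f x = dir_deriv v g x"
proof -
  have "(f has_derivative f') (at x) \<longleftrightarrow> (g has_derivative f') (at x)" for f'
    using has_derivative_transform_within_open[OF _ assms(1,2)] assms(3) by metis
  then show ?thesis by (simp add: frechet_derivative_def)
qed

lemma differentiable_cong_open:
  assumes "open S" "x \<in> S" "\<And>y. y \<in> S \<Longrightarrow> f y = g y"
  shows "f differentiable (at x) \<longleftrightarrow> g differentiable (at x)"
  unfolding differentiable_def
  using has_derivative_transform_within_open[OF _ assms(1,2)] assms(3) by metis

lemma Ck_on_cong:
  assumes "open S" "\<And>y. y \<in> S \<Longrightarrow> f y = g y"
  shows "Ck_on k S f \<longleftrightarrow> Ck_on k S g"
  using assms(2)
proof (induction k arbitrary: f g)
  case 0
  then show ?case by (auto intro: continuous_on_cong[THEN iffD1])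
next
  case (Suc k)
  have "Ck_on k S (dir_deriv v f) \<longleftrightarrow> Ck_on k S (dir_deriv v g)" for v
    by (rule Suc.IH) (rule dir_deriv_cong[OF assms(1) _ Suc.prems])
  then show ?case
    using differentiable_cong_open[OF assms(1) _ Suc.prems] by simp
qed

lemma Ck_on_transform:
  assumes "Ck_on k S g" "open S" "\<And>y. y \<in> S \<Longrightarrow> f y = g y"
  shows "Ck_on k S f"
  using Ck_on_cong[of S f g k] assms by blast

lemma Ck_on_Suc_D:
  assumes "Ck_on (Suc k) S f"
  shows "Ck_on k S f"
  using assms
proof (induction k arbitrary: f)
  case 0
  then show ?case
    by (auto simp: continuous_on_eq_continuous_within
        intro!: differentiable_imp_continuous_within intro: differentiable_at_withinI)
next
  case (Suc k)
  from Suc.prems have "Ck_on (Suc k) S (dir_deriv v f)" for v by simp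
  from Suc.IH[OF this] show ?case using Suc.prems by simp
qed

lemma Ck_on_const: "Ck_on k S (\<lambda>_. c)"
  by (induction k arbitrary: c) simp_all

lemma Ck_on_add:
  assumes "open S" "Ck_on k S f" "Ck_on k S g"
  shows "Ck_on k S (\<lambda>x. f x + g x)"
  using assms(2,3)
proof (induction k arbitrary: f g)
  case 0
  then show ?case by (simp add: continuous_on_add)
next
  case (Suc k)
  have "Ck_on k S (dir_deriv v (\<lambda>x. f x + g x))" for v
  proof -
    have "Ck_on k S (\<lambda>x. dir_deriv v f x + dir_deriv v g x)"
      using Suc by simp
    moreover have "dir_deriv v (\<lambda>x. f x + g x) x = dir_deriv v f x + dir_deriv v g x" if "x \<in> S" for x
      using Suc.prems that
      by (intro dir_deriv_eq has_derivative_add) (simp_all add: frechet_derivative_works[symmetric])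
    ultimately show ?thesis by (rule Ck_on_transform[OF _ assms(1)])
  qed
  then show ?case using Suc.prems by simp
qed

text \<open>The induction leaves \<open>f\<close> and \<open>g\<close> arbitrary because the product
  rule pairs each factor with a derivative of the other. Scalar and vector products are
  instances.\<close>

lemma Ck_on_bilinear:
  assumes "open S" "bounded_bilinear p" "Ck_on k S f" "Ck_on k S g"
  shows "Ck_on k S (\<lambda>x. p (f x) (g x))"
  using assms(3,4)
proof (induction k arbitrary: f g)
  case 0
  then show ?case by (simp add: bounded_bilinear.continuous_on[OF assms(2)])
next
  case (Suc k)
  have d: "((\<lambda>x. p (f x) (g x)) has_derivative
      (\<lambda>v. p (f x) (dir_deriv v g x) + p (dir_deriv v f x) (g x))) (at x)" if "x \<in> S" for x
    using Suc.prems that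
    by (intro bounded_bilinear.FDERIV[OF assms(2)]) (simp_all add: frechet_derivative_works[symmetric])
  have "Ck_on k S (dir_deriv v (\<lambda>x. p (f x) (g x)))" for v
  proof -
    have "Ck_on k S (\<lambda>x. p (f x) (dir_deriv v g x) + p (dir_deriv v f x) (g x))"
      using Suc.prems Ck_on_Suc_D[OF Suc.prems(1)] Ck_on_Suc_D[OF Suc.prems(2)]
      by (intro Ck_on_add[OF assms(1)] Suc.IH) simp_all
    then show ?thesis by (rule Ck_on_transform[OF _ assms(1)]) (rule dir_deriv_eq[OF d])
  qed
  moreover have "(\<lambda>x. p (f x) (g x)) differentiable (at x)" if "x \<in> S" for x
    using d[OF that] by (rule differentiableI)
  ultimately show ?case by simp
qed

lemma Ck_on_inverse:
  fixes f :: "'a::real_normed_vector \<Rightarrow> real"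
  assumes "open S" "\<And>x. x \<in> S \<Longrightarrow> f x \<noteq> 0" "Ck_on k S f"
  shows "Ck_on k S (\<lambda>x. inverse (f x))"
  using assms(3)
proof (induction k)
  case 0
  then show ?case using assms(2) by (simp add: continuous_on_inverse)
next
  case (Suc k)
  have d: "((\<lambda>x. inverse (f x)) has_derivative
      (\<lambda>v. - (inverse (f x) * dir_deriv v f x * inverse (f x)))) (at x)" if "x \<in> S" for x
    using Suc.prems that assms(2)
    by (intro Deriv.has_derivative_inverse) (simp_all add: frechet_derivative_works[symmetric])
  have i: "Ck_on k S (\<lambda>x. inverse (f x))"
    using Suc.IH Ck_on_Suc_D[OF Suc.prems] by blast
  have "Ck_on k S (dir_deriv v (\<lambda>x. inverse (f x)))" for v
  proof -
    \<comment> \<open>The derivative of the reciprocal contains the reciprocal itself, which is of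
      class k by the induction hypothesis.\<close>
    have "Ck_on k S (\<lambda>x. (- 1) * (inverse (f x) * dir_deriv v f x * inverse (f x)))"
      using Suc.prems i Ck_on_const
      by (intro Ck_on_bilinear[OF assms(1) bounded_bilinear_mult]) simp_all
    then show ?thesis by (rule Ck_on_transform[OF _ assms(1)]) (simp add: dir_deriv_eq[OF d])
  qed
  moreover have "(\<lambda>x. inverse (f x)) differentiable (at x)" if "x \<in> S" for x
    using d[OF that] by (rule differentiableI)
  ultimately show ?case by simp
qed

lemma smooth_on_transform:
  assumes "smooth_on S g" "open S" "\<And>y. y \<in> S \<Longrightarrow> f y = g y"
  shows "smooth_on S f"
  using Ck_on_transform[OF _ assms(2,3)] assms(1) by (simp add: smooth_on_def)

lemma smooth_on_differentiable: "smooth_on S f \<Longrightarrow> x \<in> S \<Longrightarrow> f differentiable (at x)"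
  unfolding smooth_on_def by (drule spec[of _ "Suc 0"]) simp

lemma smooth_on_has_derivative:
  "smooth_on S f \<Longrightarrow> x \<in> S \<Longrightarrow> (f has_derivative (\<lambda>v. dir_deriv v f x)) (at x)"
  using smooth_on_differentiable[of S f x] by (simp add: frechet_derivative_works)

lemma smooth_on_dir_deriv: "smooth_on S f \<Longrightarrow> smooth_on S (dir_deriv v f)"
  unfolding smooth_on_def by (metis Ck_on.simps(2))

lemma smooth_on_continuous: "smooth_on S f \<Longrightarrow> continuous_on S f"
  unfolding smooth_on_def by (metis Ck_on.simps(1))

lemma smooth_on_const [simp]: "smooth_on S (\<lambda>_. c)"
  by (simp add: smooth_on_def Ck_on_const)

lemma smooth_on_add: "open S \<Longrightarrow> smooth_on S f \<Longrightarrow> smooth_on S g \<Longrightarrow> smooth_on S (\<lambda>x. f x + g x)"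
  by (simp add: smooth_on_def Ck_on_add)

lemma smooth_on_bilinear:
  "open S \<Longrightarrow> bounded_bilinear p \<Longrightarrow> smooth_on S f \<Longrightarrow> smooth_on S g \<Longrightarrow> smooth_on S (\<lambda>x. p (f x) (g x))"
  by (simp add: smooth_on_def Ck_on_bilinear)

lemmas smooth_on_mult = smooth_on_bilinear[OF _ bounded_bilinear_mult]
lemmas smooth_on_scaleR = smooth_on_bilinear[OF _ bounded_bilinear_scaleR]

lemma smooth_on_linear:
  assumes "open S" "bounded_linear T" "smooth_on S f"
  shows "smooth_on S (\<lambda>x. T (f x))"
proof -
  \<comment> \<open>Pairing with a scalar makes a linear map bilinear; the constant scalar 1 then
    reduces the claim to the rule for products.\<close>
  have "bounded_bilinear (\<lambda>(r::real) y. r *\<^sub>R T y)"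
    using bounded_bilinear.comp[OF bounded_bilinear_scaleR bounded_linear_ident assms(2)] .
  from smooth_on_bilinear[OF assms(1) this smooth_on_const[of S 1] assms(3)] show ?thesis by simp
qed

lemma smooth_on_minus: "open S \<Longrightarrow> smooth_on S f \<Longrightarrow> smooth_on S (\<lambda>x. - f x)"
  by (rule smooth_on_linear) (simp_all add: bounded_linear_minus)

lemma smooth_on_diff: "open S \<Longrightarrow> smooth_on S f \<Longrightarrow> smooth_on S g \<Longrightarrow> smooth_on S (\<lambda>x. f x - g x)"
  using smooth_on_add[of S f "\<lambda>x. - g x"] smooth_on_minus[of S g] by simp

lemma smooth_on_sum:
  assumes "open S" "\<And>i. i \<in> I \<Longrightarrow> smooth_on S (f i)"
  shows "smooth_on S (\<lambda>x. \<Sum>i\<in>I. f i x)"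
  using assms(2) by (induction I rule: infinite_finite_induct) (simp_all add: smooth_on_add assms(1))

lemma smooth_on_prod:
  fixes f :: "'i \<Rightarrow> 'a::real_normed_vector \<Rightarrow> real"
  assumes "open S" "\<And>i. i \<in> I \<Longrightarrow> smooth_on S (f i)"
  shows "smooth_on S (\<lambda>x. \<Prod>i\<in>I. f i x)"
  using assms(2) by (induction I rule: infinite_finite_induct) (simp_all add: smooth_on_mult assms(1))

lemma smooth_on_inverse:
  fixes f :: "'a::real_normed_vector \<Rightarrow> real"
  shows "open S \<Longrightarrow> (\<And>x. x \<in> S \<Longrightarrow> f x \<noteq> 0) \<Longrightarrow> smooth_on S f \<Longrightarrow> smooth_on S (\<lambda>x. inverse (f x))"
  by (simp add: smooth_on_def Ck_on_inverse)

section \<open>Vectors and matrices with smooth entries\<close>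

lemma smooth_on_nth:
  "open S \<Longrightarrow> smooth_on S f \<Longrightarrow> smooth_on S (\<lambda>x. f x $ i)"
  by (rule smooth_on_linear[OF _ bounded_linear_vec_nth])

lemma vec_lambda_expansion: "(\<chi> k. f k) = (\<Sum>k\<in>UNIV. f k *\<^sub>R axis k (1::real))"
  using basis_expansion[of "\<chi> k. f k"] by (simp add: scalar_mult_eq_scaleR)

lemma smooth_on_vec_lambda:
  fixes f :: "'n::finite \<Rightarrow> 'a::real_normed_vector \<Rightarrow> real"
  assumes "open S" "\<And>k. smooth_on S (f k)"
  shows "smooth_on S (\<lambda>x. \<chi> k. f k x)"
  unfolding vec_lambda_expansion using assms
  by (intro smooth_on_sum smooth_on_scaleR) simp_all

lemma smooth_on_det:
  fixes M :: "'a::real_normed_vector \<Rightarrow> real ^ 'n ^ 'n::finite"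
  assumes "open S" "\<And>i j. smooth_on S (\<lambda>x. M x $ i $ j)"
  shows "smooth_on S (\<lambda>x. det (M x))"
  unfolding det_def using assms
  by (intro smooth_on_sum smooth_on_mult smooth_on_prod) simp_all

text \<open>Cramer's rule for the right-hand side \<open>axis l 1\<close>. It writes the inverse
  through determinants, from which its smoothness can be read off.\<close>

lemma matrix_inv_component:
  fixes A :: "real ^ 'n ^ 'n::finite"
  assumes "invertible A"
  shows "matrix_inv A $ k $ l =
    det (\<chi> i j. if j = k then axis l 1 $ i else A $ i $ j) * inverse (det A)"
proof -
  have "A ** matrix_inv A = mat 1"
    using someI_ex[OF assms[unfolded invertible_def], folded matrix_inv_def] by blast
  then have "A *v (matrix_inv A *v axis l 1) = axis l 1"
    by (simp add: matrix_vector_mul_assoc)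
  moreover have "det A \<noteq> 0"
    using assms invertible_det_nz by blast
  ultimately have "matrix_inv A *v axis l 1 =
      (\<chi> k. det (\<chi> i j. if j = k then axis l 1 $ i else A $ i $ j) / det A)"
    using cramer[of A "matrix_inv A *v axis l 1" "axis l 1"] by simp
  then have "(matrix_inv A *v axis l 1) $ k =
      det (\<chi> i j. if j = k then axis l 1 $ i else A $ i $ j) / det A"
    by simp
  moreover have "(matrix_inv A *v axis l 1) $ k = matrix_inv A $ k $ l"
    by (simp add: matrix_vector_mul_component inner_axis)
  ultimately show ?thesis by (simp add: divide_inverse)
qed

lemma smooth_on_matrix_inv:
  fixes M :: "'a::real_normed_vector \<Rightarrow> real ^ 'n ^ 'n::finite"
  assumes "open S" "smooth_on S M" "\<And>x. x \<in> S \<Longrightarrow> invertible (M x)"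
  shows "smooth_on S (\<lambda>x. matrix_inv (M x) $ k $ l)"
proof -
  have M: "smooth_on S (\<lambda>x. M x $ i $ j)" for i j
    using smooth_on_nth[OF assms(1) smooth_on_nth[OF assms(1,2)]] .
  have "smooth_on S (\<lambda>x. det (\<chi> i j. if j = k then axis l 1 $ i else M x $ i $ j))"
  proof (rule smooth_on_det[OF assms(1)])
    fix i j show "smooth_on S (\<lambda>x. (\<chi> i j. if j = k then axis l 1 $ i else M x $ i $ j) $ i $ j)"
      by (cases "j = k") (simp_all add: M)
  qed
  moreover have "smooth_on S (\<lambda>x. inverse (det (M x)))"
    using assms(3) M smooth_on_det[OF assms(1)]
    by (intro smooth_on_inverse[OF assms(1)]) (auto simp: invertible_det_nz)
  ultimately have "smooth_on S (\<lambda>x. det (\<chi> i j. if j = k then axis l 1 $ i else M x $ i $ j)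
      * inverse (det (M x)))"
    using smooth_on_mult[OF assms(1)] by blast
  then show ?thesis
    by (rule smooth_on_transform[OF _ assms(1)]) (rule matrix_inv_component[OF assms(3)])
qed

section \<open>Symmetry of second derivatives\<close>

lemma DERIV_along_line:
  fixes f :: "'a::real_normed_vector \<Rightarrow> real"
  assumes "f differentiable (at (p + s *\<^sub>R u))"
  shows "((\<lambda>s. f (p + s *\<^sub>R u)) has_real_derivative dir_deriv u f (p + s *\<^sub>R u)) (at s)"
proof -
  let ?D = "frechet_derivative f (at (p + s *\<^sub>R u))"
  have "((\<lambda>s. p + s *\<^sub>R u) has_derivative (\<lambda>h. h *\<^sub>R u)) (at s)"
    by (auto intro!: derivative_eq_intros)
  from has_derivative_compose[OF this assms[unfolded frechet_derivative_works]]
  have "((\<lambda>s. f (p + s *\<^sub>R u)) has_derivative (\<lambda>h. ?D (h *\<^sub>R u))) (at s)" .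
  moreover have "?D (h *\<^sub>R u) = ?D u * h" for h
    using linear_scale[OF linear_frechet_derivative[OF assms]] by simp
  ultimately show ?thesis by (simp add: has_field_derivative_def)
qed

text \<open>The mean value theorem is used twice: along \<open>u\<close> for the difference across
  \<open>v\<close>, then along \<open>v\<close> for the derivative in direction
  \<open>u\<close>.\<close>

lemma second_difference_mean_value:
  fixes f :: "'a::real_normed_vector \<Rightarrow> real"
  assumes f: "smooth_on S f" and t: "t > 0" and S: "ball x r \<subseteq> S" "t * (norm u + norm v) < r"
  obtains y where "dist x y \<le> t * (norm u + norm v)"
    "f (x + t *\<^sub>R u + t *\<^sub>R v) - f (x + t *\<^sub>R u) - f (x + t *\<^sub>R v) + f x =
      t\<^sup>2 * dir_deriv v (dir_deriv u f) y"
proof -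
  have close: "dist x (x + a *\<^sub>R u + b *\<^sub>R v) \<le> t * (norm u + norm v)" if "0 \<le> a" "a \<le> t" "0 \<le> b" "b \<le> t" for a b
  proof -
    have "dist x (x + a *\<^sub>R u + b *\<^sub>R v) = norm (a *\<^sub>R u + b *\<^sub>R v)"
      by (simp add: dist_norm norm_minus_commute algebra_simps)
    also have "\<dots> \<le> a * norm u + b * norm v"
      using norm_triangle_ineq[of "a *\<^sub>R u" "b *\<^sub>R v"] that by simp
    also have "\<dots> \<le> t * (norm u + norm v)"
      using that by (simp add: distrib_left add_mono mult_right_mono)
    finally show ?thesis .
  qed
  then have inS: "x + a *\<^sub>R u + b *\<^sub>R v \<in> S" if "0 \<le> a" "a \<le> t" "0 \<le> b" "b \<le> t" for a b
    using S that by fastforce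
  have d1: "((\<lambda>s. f (x + s *\<^sub>R u + b *\<^sub>R v)) has_real_derivative dir_deriv u f (x + s *\<^sub>R u + b *\<^sub>R v)) (at s)"
    if "0 \<le> s" "s \<le> t" "0 \<le> b" "b \<le> t" for s b
  proof -
    have eq: "x + r *\<^sub>R u + b *\<^sub>R v = x + b *\<^sub>R v + r *\<^sub>R u" for r by simp
    show ?thesis
      unfolding eq by (rule DERIV_along_line, fold eq, rule smooth_on_differentiable[OF f inS[OF that]])
  qed
  have "\<exists>z>0. z < t \<and> (f (x + t *\<^sub>R u + t *\<^sub>R v) - f (x + t *\<^sub>R u + 0 *\<^sub>R v)) -
     (f (x + 0 *\<^sub>R u + t *\<^sub>R v) - f (x + 0 *\<^sub>R u + 0 *\<^sub>R v)) =
     (t - 0) * (dir_deriv u f (x + z *\<^sub>R u + t *\<^sub>R v) - dir_deriv u f (x + z *\<^sub>R u + 0 *\<^sub>R v))"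
    by (rule MVT2[OF t, where f = "\<lambda>s. f (x + s *\<^sub>R u + t *\<^sub>R v) - f (x + s *\<^sub>R u + 0 *\<^sub>R v)"])
      (use t in \<open>intro DERIV_diff d1; simp\<close>)
  then obtain z where z: "0 < z" "z < t" and
    1: "f (x + t *\<^sub>R u + t *\<^sub>R v) - f (x + t *\<^sub>R u) - f (x + t *\<^sub>R v) + f x =
      t * (dir_deriv u f (x + z *\<^sub>R u + t *\<^sub>R v) - dir_deriv u f (x + z *\<^sub>R u))"
    by auto
  have "\<exists>w>0. w < t \<and> dir_deriv u f (x + z *\<^sub>R u + t *\<^sub>R v) - dir_deriv u f (x + z *\<^sub>R u + 0 *\<^sub>R v) =
      (t - 0) * dir_deriv v (dir_deriv u f) (x + z *\<^sub>R u + w *\<^sub>R v)"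
    by (rule MVT2[OF t, where f = "\<lambda>s. dir_deriv u f (x + z *\<^sub>R u + s *\<^sub>R v)"])
      (use z in \<open>intro DERIV_along_line smooth_on_differentiable[OF smooth_on_dir_deriv[OF f]] inS; simp\<close>)
  then obtain w where w: "0 < w" "w < t" and
    2: "dir_deriv u f (x + z *\<^sub>R u + t *\<^sub>R v) - dir_deriv u f (x + z *\<^sub>R u) =
      t * dir_deriv v (dir_deriv u f) (x + z *\<^sub>R u + w *\<^sub>R v)"
    by auto
  show thesis
    by (rule that[OF close[of z w]]) (use z w 1 2 in \<open>simp_all add: power2_eq_square\<close>)
qed

text \<open>The second difference is symmetric in \<open>u\<close> and \<open>v\<close>, so the two
  mixed derivatives take a common value at points arbitrarily near \<open>x\<close>. By continuity
  they cannot differ at \<open>x\<close>.\<close>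

lemma dir_deriv_commute_real:
  fixes f :: "'a::real_normed_vector \<Rightarrow> real"
  assumes S: "open S" "x \<in> S" and f: "smooth_on S f"
  shows "dir_deriv u (dir_deriv v f) x = dir_deriv v (dir_deriv u f) x"
proof (rule ccontr)
  let ?A = "dir_deriv u (dir_deriv v f)" and ?B = "dir_deriv v (dir_deriv u f)"
  define d where "d = \<bar>?A x - ?B x\<bar> / 2"
  assume "?A x \<noteq> ?B x"
  then have "d > 0" by (simp add: d_def)
  have c: "continuous (at x) ?A" "continuous (at x) ?B"
    using S smooth_on_continuous[OF smooth_on_dir_deriv[OF smooth_on_dir_deriv[OF f]]]
    by (simp_all add: continuous_on_eq_continuous_at)
  obtain r1 where r1: "r1 > 0" "\<And>y. dist y x < r1 \<Longrightarrow> dist (?A y) (?A x) < d"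
    using c(1) \<open>d > 0\<close> unfolding continuous_at_eps_delta by metis
  obtain r2 where r2: "r2 > 0" "\<And>y. dist y x < r2 \<Longrightarrow> dist (?B y) (?B x) < d"
    using c(2) \<open>d > 0\<close> unfolding continuous_at_eps_delta by metis
  obtain r3 where r3: "r3 > 0" "ball x r3 \<subseteq> S"
    using S by (meson openE)
  define r where "r = min r1 (min r2 r3)"
  \<comment> \<open>The summand 1 keeps the denominator positive and the bound by \<open>r\<close>
    strict, also when \<open>u\<close> and \<open>v\<close> are both zero.\<close>
  define t where "t = r / (norm u + norm v + 1)"
  have "r > 0" using r1 r2 r3 by (simp add: r_def)
  have t: "t > 0" "t * (norm u + norm v) < r"
    using \<open>r > 0\<close> by (simp_all add: t_def add_nonneg_pos field_simps add_pos_nonneg)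
  have b: "ball x r \<subseteq> S" using r3 by (auto simp: r_def)
  obtain y where y: "dist x y \<le> t * (norm u + norm v)"
    "f (x + t *\<^sub>R u + t *\<^sub>R v) - f (x + t *\<^sub>R u) - f (x + t *\<^sub>R v) + f x = t\<^sup>2 * ?B y"
    by (rule second_difference_mean_value[OF f t(1) b t(2)])
  obtain z where z: "dist x z \<le> t * (norm u + norm v)"
    "f (x + t *\<^sub>R v + t *\<^sub>R u) - f (x + t *\<^sub>R v) - f (x + t *\<^sub>R u) + f x = t\<^sup>2 * ?A z"
    by (rule second_difference_mean_value[OF f t(1) b, of v u]) (use t in \<open>simp_all add: add.commute\<close>)
  have "t\<^sup>2 * ?B y = t\<^sup>2 * ?A z"
    using y(2) z(2) by (simp add: algebra_simps)
  then have "?B y = ?A z" using t by simp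
  moreover have "dist (?A z) (?A x) < d" "dist (?B y) (?B x) < d"
    using r1(2)[of z] r2(2)[of y] y(1) z(1) t(2) by (simp_all add: r_def dist_commute)
  ultimately show False unfolding d_def dist_real_def by (smt (verit) field_sum_of_halves)
qed

lemma dir_deriv_linear:
  assumes "bounded_linear T" "f differentiable (at x)"
  shows "dir_deriv v (\<lambda>y. T (f y)) x = T (dir_deriv v f x)"
  by (rule dir_deriv_eq) (rule bounded_linear.has_derivative[OF assms(1) assms(2)[unfolded frechet_derivative_works]])

lemma dir_deriv_nth:
  assumes "f differentiable (at x)"
  shows "dir_deriv v (\<lambda>y. f y $ i) x = dir_deriv v f x $ i"
  using dir_deriv_linear[OF bounded_linear_vec_nth assms] .

lemma dir_deriv_commute:
  fixes f :: "'a::real_normed_vector \<Rightarrow> real ^ 'n::finite"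
  assumes S: "open S" "x \<in> S" and f: "smooth_on S f"
  shows "dir_deriv u (dir_deriv v f) x = dir_deriv v (dir_deriv u f) x"
proof (rule vec_eq_iff[THEN iffD2], rule allI)
  fix i
  have *: "dir_deriv u (dir_deriv v f) x $ i = dir_deriv u (dir_deriv v (\<lambda>y. f y $ i)) x" for u v
  proof -
    have "dir_deriv u (dir_deriv v f) x $ i = dir_deriv u (\<lambda>y. dir_deriv v f y $ i) x"
      by (rule dir_deriv_nth[symmetric]) (rule smooth_on_differentiable[OF smooth_on_dir_deriv[OF f] S(2)])
    also have "\<dots> = dir_deriv u (dir_deriv v (\<lambda>y. f y $ i)) x"
      by (rule dir_deriv_cong[OF S]) (rule dir_deriv_nth[symmetric], rule smooth_on_differentiable[OF f])
    finally show ?thesis .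
  qed
  show "dir_deriv u (dir_deriv v f) x $ i = dir_deriv v (dir_deriv u f) x $ i"
    unfolding * by (rule dir_deriv_commute_real[OF S smooth_on_nth[OF S(1) f]])
qed

lemma linear_axis_expansion:
  fixes T :: "real ^ 'n::finite \<Rightarrow> 'b::real_vector"
  assumes "linear T"
  shows "T u = (\<Sum>i\<in>UNIV. u $ i *\<^sub>R T (axis i 1))"
proof -
  have "T u = T (\<Sum>i\<in>UNIV. u $ i *\<^sub>R axis i 1)"
    using basis_expansion[of u] by (simp add: scalar_mult_eq_scaleR)
  then show ?thesis by (simp add: linear_sum[OF assms] linear_scale[OF assms])
qed

text \<open>The product rule for a smooth family of linear maps, available without a normed space of
  such maps.\<close>

lemma
  fixes L :: "'a::real_normed_vector \<Rightarrow> real ^ 'n::finite \<Rightarrow> 'b::real_normed_vector"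
  assumes S: "open S" and lin: "\<And>y. y \<in> S \<Longrightarrow> linear (L y)" and L: "\<And>u. smooth_on S (\<lambda>y. L y u)"
    and Y: "smooth_on S Y"
  shows smooth_on_apply: "smooth_on S (\<lambda>y. L y (Y y))"
    and dir_deriv_apply: "x \<in> S \<Longrightarrow>
      dir_deriv v (\<lambda>y. L y (Y y)) x = dir_deriv v (\<lambda>y. L y (Y x)) x + L x (dir_deriv v Y x)"
proof -
  have e: "L y u = (\<Sum>i\<in>UNIV. u $ i *\<^sub>R L y (axis i 1))" if "y \<in> S" for y u
    by (rule linear_axis_expansion[OF lin[OF that]])
  have "smooth_on S (\<lambda>y. \<Sum>i\<in>UNIV. Y y $ i *\<^sub>R L y (axis i 1))"
    by (intro smooth_on_sum smooth_on_scaleR smooth_on_nth S Y L)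
  then show "smooth_on S (\<lambda>y. L y (Y y))"
    by (rule smooth_on_transform[OF _ S]) (rule e)
  assume x: "x \<in> S"
  have "((\<lambda>y. \<Sum>i\<in>UNIV. Y y $ i *\<^sub>R L y (axis i 1)) has_derivative
     (\<lambda>v. \<Sum>i\<in>UNIV. Y x $ i *\<^sub>R dir_deriv v (\<lambda>y. L y (axis i 1)) x + dir_deriv v Y x $ i *\<^sub>R L x (axis i 1))) (at x)"
    by (intro has_derivative_sum has_derivative_scaleR bounded_linear.has_derivative[OF bounded_linear_vec_nth]
       smooth_on_has_derivative[OF _ x] L Y)
  moreover have "((\<lambda>y. \<Sum>i\<in>UNIV. Y x $ i *\<^sub>R L y (axis i 1)) has_derivative
     (\<lambda>v. \<Sum>i\<in>UNIV. Y x $ i *\<^sub>R dir_deriv v (\<lambda>y. L y (axis i 1)) x)) (at x)"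
    by (intro has_derivative_sum has_derivative_scaleR_right smooth_on_has_derivative[OF _ x] L)
  ultimately show "dir_deriv v (\<lambda>y. L y (Y y)) x = dir_deriv v (\<lambda>y. L y (Y x)) x + L x (dir_deriv v Y x)"
    using dir_deriv_cong[OF S x e, of "\<lambda>y. y" Y v] dir_deriv_cong[OF S x e, of "\<lambda>y. y" "\<lambda>_. Y x" v]
    by (simp add: dir_deriv_eq sum.distrib e[OF x, of "dir_deriv v Y x"])
qed

section \<open>Tensor calculus in a chart\<close>

definition christoffel_map :: "(real ^ 'n \<Rightarrow> real ^ 'n ^ 'n) \<Rightarrow> real ^ 'n \<Rightarrow> real ^ 'n \<Rightarrow> real ^ 'n \<Rightarrow> real ^ 'n::finite" where
  "christoffel_map G x u w = (\<chi> k. \<Sum>i\<in>UNIV. \<Sum>j\<in>UNIV. christoffel G x k i j * u $ i * w $ j)"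

text \<open>The direction is a fixed coordinate vector, not a field. Constant fields have vanishing
  brackets, so iterated derivatives produce no bracket terms.\<close>

definition cov_deriv :: "(real ^ 'n \<Rightarrow> real ^ 'n ^ 'n) \<Rightarrow> real ^ 'n \<Rightarrow> 'n vfield \<Rightarrow> 'n::finite vfield" where
  "cov_deriv G v Z = (\<lambda>x. dir_deriv v Z x + christoffel_map G x v (Z x))"

text \<open>The curvature on constant fields: the bracket vanishes, and the derivative of the
  constant field \<open>w\<close> along \<open>v\<close> is
  \<open>christoffel_map G y v w\<close>.\<close>

definition curv_tensor :: "(real ^ 'n \<Rightarrow> real ^ 'n ^ 'n) \<Rightarrow> real ^ 'n \<Rightarrow> real ^ 'n \<Rightarrow> real ^ 'n \<Rightarrow> real ^ 'n \<Rightarrow> real ^ 'n::finite" where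
  "curv_tensor G x u v w = cov_deriv G u (\<lambda>y. christoffel_map G y v w) x - cov_deriv G v (\<lambda>y. christoffel_map G y u w) x"

definition nabla_curv_tensor :: "(real ^ 'n \<Rightarrow> real ^ 'n ^ 'n) \<Rightarrow> real ^ 'n \<Rightarrow> real ^ 'n \<Rightarrow> real ^ 'n \<Rightarrow> real ^ 'n \<Rightarrow> real ^ 'n \<Rightarrow> real ^ 'n::finite" where
  "nabla_curv_tensor G x v a b c = cov_deriv G v (\<lambda>y. curv_tensor G y a b c) x
     - curv_tensor G x (christoffel_map G x v a) b c
     - curv_tensor G x a (christoffel_map G x v b) c
     - curv_tensor G x a b (christoffel_map G x v c)"

lemma linear_eq_on_axes:
  fixes f h :: "real ^ 'n::finite \<Rightarrow> 'b::real_vector"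
  assumes "linear f" "linear h" "\<And>i. f (axis i 1) = h (axis i 1)"
  shows "f u = h u"
  unfolding linear_axis_expansion[OF assms(1), of u] linear_axis_expansion[OF assms(2), of u] assms(3) ..

text \<open>Needed because a trace over fixed coordinate axes, once differentiated, leaves two
  Christoffel terms that must cancel.\<close>

lemma trace_commute:
  fixes f h :: "real ^ 'n::finite \<Rightarrow> real ^ 'n"
  assumes "linear f" "linear h"
  shows "(\<Sum>k\<in>UNIV. f (h (axis k 1)) $ k) = (\<Sum>k\<in>UNIV. h (f (axis k 1)) $ k)"
proof -
  have "(\<Sum>k\<in>UNIV. f (h (axis k 1)) $ k) = (\<Sum>k\<in>UNIV. \<Sum>i\<in>UNIV. h (axis k 1) $ i * f (axis i 1) $ k)"
    by (subst linear_axis_expansion[OF assms(1)]) simp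
  also have "\<dots> = (\<Sum>i\<in>UNIV. \<Sum>k\<in>UNIV. h (axis k 1) $ i * f (axis i 1) $ k)"
    by (rule sum.swap)
  also have "\<dots> = (\<Sum>i\<in>UNIV. h (f (axis i 1)) $ i)"
    by (subst (2) linear_axis_expansion[OF assms(2)]) (simp add: mult.commute)
  finally show ?thesis .
qed

lemma bilin_add_left: "bilin B (u + v) w = bilin B u w + bilin B v w"
  and bilin_add_right: "bilin B w (u + v) = bilin B w u + bilin B w v"
  and bilin_scaleR_left: "bilin B (r *\<^sub>R u) w = r * bilin B u w"
  and bilin_scaleR_right: "bilin B w (r *\<^sub>R u) = r * bilin B w u"
  for B :: "real ^ 'n ^ 'n::finite"
  by (simp_all add: bilin_def inner_add_left inner_add_right matrix_vector_right_distrib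
      matrix_vector_mult_scaleR)

lemma bilin_diff_left: "bilin B (u - v) w = bilin B u w - bilin B v w"
  and bilin_diff_right: "bilin B w (u - v) = bilin B w u - bilin B w v"
  for B :: "real ^ 'n ^ 'n::finite"
  using bilin_add_left[of B "u - v" v w] bilin_add_right[of B w "u - v" v] by simp_all

lemma linear_bilin_left: "linear (\<lambda>u. bilin B u w)"
  for B :: "real ^ 'n ^ 'n::finite"
  by (intro linearI; simp add: bilin_add_left bilin_scaleR_left)

locale metric_chart =
  fixes S :: "(real ^ 'n::finite) set" and G :: "real ^ 'n \<Rightarrow> real ^ 'n ^ 'n"
  assumes S: "open S" and G: "smooth_on S G"
    and symG: "\<And>x. x \<in> S \<Longrightarrow> transpose (G x) = G x"
    and invG: "\<And>x. x \<in> S \<Longrightarrow> invertible (G x)"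
begin

abbreviation "\<Gamma> \<equiv> christoffel_map G"
abbreviation "N \<equiv> cov_deriv G"
abbreviation "Rm \<equiv> curv_tensor G"
abbreviation "\<beta> x \<equiv> bilin (G x)"

lemma smooth_christoffel: "smooth_on S (\<lambda>x. christoffel G x k i j)"
proof -
  have p: "smooth_on S (\<lambda>x. partial_metric G x i j l)" for i j l
    unfolding partial_metric_def by (intro smooth_on_nth smooth_on_dir_deriv S G)
  show ?thesis
    unfolding christoffel_def
    by (intro smooth_on_mult[OF S] smooth_on_const smooth_on_sum[OF S] smooth_on_diff[OF S]
        smooth_on_add[OF S] p smooth_on_matrix_inv[OF S G] invG)
qed

lemma smooth_\<Gamma>: "smooth_on S (\<lambda>x. \<Gamma> x u w)"
  unfolding christoffel_map_def
  by (intro smooth_on_vec_lambda[OF S] smooth_on_sum[OF S] smooth_on_mult[OF S] smooth_christoffel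
      smooth_on_const)

lemma linear_\<Gamma>_left: "linear (\<lambda>u. \<Gamma> x u w)"
  by (rule linearI)
    (simp_all add: christoffel_map_def vec_eq_iff sum.distrib[symmetric] sum_distrib_left algebra_simps)

lemma linear_\<Gamma>_right: "linear (\<Gamma> x u)"
  by (rule linearI)
    (simp_all add: christoffel_map_def vec_eq_iff sum.distrib[symmetric] sum_distrib_left algebra_simps)

lemma \<Gamma>_sym:
  assumes "x \<in> S"
  shows "\<Gamma> x u w = \<Gamma> x w u"
proof -
  have "(\<Sum>i\<in>UNIV. \<Sum>j\<in>UNIV. christoffel G x k i j * u $ i * w $ j) =
        (\<Sum>i\<in>UNIV. \<Sum>j\<in>UNIV. christoffel G x k i j * w $ i * u $ j)" for k
    by (subst sum.swap) (intro sum.cong refl,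
      simp add: christoffel_sym[OF S assms smooth_on_differentiable[OF G assms] symG, of k] mult_ac)
  then show ?thesis by (simp add: christoffel_map_def)
qed

lemma \<beta>_sym: "x \<in> S \<Longrightarrow> \<beta> x u w = \<beta> x w u"
proof -
  assume "x \<in> S"
  then have "w v* G x = G x *v w"
    using transpose_matrix_vector[of "G x" w] symG by simp
  then show "\<beta> x u w = \<beta> x w u"
    unfolding bilin_def using dot_lmul_matrix[of w "G x" u] by (simp add: inner_commute)
qed

lemma N_const: "N v (\<lambda>_. w) = (\<lambda>x. \<Gamma> x v w)"
  by (simp add: cov_deriv_def)

lemma levi_civita_eq_N: "levi_civita G X Y x = N (X x) Y x"
  by (simp add: levi_civita_def cov_deriv_def christoffel_map_def)

lemma N_cong:
  assumes "x \<in> S" "\<And>y. y \<in> S \<Longrightarrow> Y y = Z y"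
  shows "N v Y x = N v Z x"
  using dir_deriv_cong[OF S assms] assms by (simp add: cov_deriv_def)

lemma smooth_N:
  assumes "smooth_on S Z"
  shows "smooth_on S (N v Z)"
  unfolding cov_deriv_def
  by (intro smooth_on_add[OF S] smooth_on_dir_deriv assms
      smooth_on_apply[OF S linear_\<Gamma>_right smooth_\<Gamma>])

lemma linear_N_dir:
  assumes "x \<in> S" "smooth_on S Z"
  shows "linear (\<lambda>v. N v Z x)"
  unfolding cov_deriv_def
  by (intro linear_compose_add linear_\<Gamma>_left linear_frechet_derivative
      smooth_on_differentiable[OF assms(2,1)])

lemma N_add:
  assumes "x \<in> S" "smooth_on S Y" "smooth_on S Z"
  shows "N v (\<lambda>y. Y y + Z y) x = N v Y x + N v Z x"
  using dir_deriv_eq[OF has_derivative_add[OF smooth_on_has_derivative[OF assms(2,1)]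
      smooth_on_has_derivative[OF assms(3,1)]]] linear_add[OF linear_\<Gamma>_right]
  by (simp add: cov_deriv_def)

lemma N_scaleR:
  assumes "x \<in> S" "smooth_on S Z"
  shows "N v (\<lambda>y. r *\<^sub>R Z y) x = r *\<^sub>R N v Z x"
  using dir_deriv_eq[OF has_derivative_scaleR_right[OF smooth_on_has_derivative[OF assms(2,1)]]]
    linear_scale[OF linear_\<Gamma>_right]
  by (simp add: cov_deriv_def scaleR_add_right)

lemma N_diff:
  assumes "x \<in> S" "smooth_on S Y" "smooth_on S Z"
  shows "N v (\<lambda>y. Y y - Z y) x = N v Y x - N v Z x"
  using N_add[OF assms(1) smooth_on_diff[OF S assms(2,3)] assms(3)] by (simp add: algebra_simps)

lemma linear_N_family:
  assumes "x \<in> S" "\<And>y. y \<in> S \<Longrightarrow> linear (L y)" "\<And>w. smooth_on S (\<lambda>y. L y w)"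
  shows "linear (\<lambda>w. N v (\<lambda>y. L y w) x)"
proof (rule linearI)
  fix w w' and r :: real
  show "N v (\<lambda>y. L y (w + w')) x = N v (\<lambda>y. L y w) x + N v (\<lambda>y. L y w') x"
    unfolding N_add[OF assms(1,3,3), symmetric]
    by (rule N_cong[OF assms(1)]) (rule linear_add[OF assms(2)])
  show "N v (\<lambda>y. L y (r *\<^sub>R w)) x = r *\<^sub>R N v (\<lambda>y. L y w) x"
    unfolding N_scaleR[OF assms(1,3), symmetric]
    by (rule N_cong[OF assms(1)]) (rule linear_scale[OF assms(2)])
qed

lemma N_apply:
  fixes L :: "real ^ 'n \<Rightarrow> real ^ 'n \<Rightarrow> real ^ 'n"
  assumes "x \<in> S" "\<And>y. y \<in> S \<Longrightarrow> linear (L y)" "\<And>w. smooth_on S (\<lambda>y. L y w)" "smooth_on S Z"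
  shows "N v (\<lambda>y. L y (Z y)) x = N v (\<lambda>y. L y (Z x)) x + L x (dir_deriv v Z x)"
  unfolding cov_deriv_def using dir_deriv_apply[OF S assms(2-4,1)] by simp

text \<open>Second partial derivatives commute, and the two terms with first derivatives of
  \<open>Z\<close> change places under exchange of \<open>u\<close> and \<open>v\<close>. Only the
  derivatives of the Christoffel map survive.\<close>

lemma N_N_commute:
  assumes x: "x \<in> S" and Z: "smooth_on S Z"
  shows "N u (N v Z) x - N v (N u Z) x = Rm x u v (Z x)"
proof -
  have "N u (N v Z) x = dir_deriv u (dir_deriv v Z) x + \<Gamma> x u (dir_deriv v Z x)
      + N u (\<lambda>y. \<Gamma> y v (Z x)) x + \<Gamma> x v (dir_deriv u Z x)" for u v
  proof -
    have "N u (N v Z) x = N u (dir_deriv v Z) x + N u (\<lambda>y. \<Gamma> y v (Z y)) x"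
      using N_add[OF x smooth_on_dir_deriv[OF Z] smooth_on_apply[OF S linear_\<Gamma>_right smooth_\<Gamma> Z]]
      by (simp add: cov_deriv_def[of G v Z])
    also have "N u (dir_deriv v Z) x = dir_deriv u (dir_deriv v Z) x + \<Gamma> x u (dir_deriv v Z x)"
      by (simp add: cov_deriv_def)
    also have "N u (\<lambda>y. \<Gamma> y v (Z y)) x = N u (\<lambda>y. \<Gamma> y v (Z x)) x + \<Gamma> x v (dir_deriv u Z x)"
      by (rule N_apply[OF x linear_\<Gamma>_right smooth_\<Gamma> Z])
    finally show ?thesis by simp
  qed
  from this[of u v] this[of v u] dir_deriv_commute[OF S x Z, of u v] show ?thesis
    by (simp add: curv_tensor_def)
qed

text \<open>Tensoriality: the outer derivative also differentiates the fields \<open>Y\<close> and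
  \<open>X\<close> that give the inner direction, and these contributions are exactly the bracket
  term.\<close>

lemma curvature_eq_Rm:
  assumes x: "x \<in> S" and X: "smooth_on S X" and Y: "smooth_on S Y" and Z: "smooth_on S Z"
  shows "curvature G X Y Z x = Rm x (X x) (Y x) (Z x)"
proof -
  have L: "linear (\<lambda>v. N v Z y)" if "y \<in> S" for y
    using linear_N_dir[OF that Z] .
  have *: "levi_civita G X (levi_civita G Y Z) x =
      N (X x) (N (Y x) Z) x + N (dir_deriv (X x) Y x) Z x" if Y: "smooth_on S Y" for X Y
    unfolding levi_civita_eq_N levi_civita_eq_N[abs_def]
    using N_apply[OF x L smooth_N[OF Z] Y] .
  have "levi_civita G (lie_bracket X Y) Z x = N (dir_deriv (X x) Y x) Z x - N (dir_deriv (Y x) X x) Z x"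
    unfolding levi_civita_eq_N lie_bracket_def using linear_diff[OF L[OF x]] .
  then show ?thesis
    unfolding curvature_def *[OF X] *[OF Y] using N_N_commute[OF x Z, of "X x" "Y x"] by simp
qed

lemma smooth_Rm_const: "smooth_on S (\<lambda>x. Rm x a b c)"
  unfolding curv_tensor_def by (intro smooth_on_diff[OF S] smooth_N smooth_\<Gamma>)

lemma linear_Rm1: "x \<in> S \<Longrightarrow> linear (\<lambda>a. Rm x a b c)"
  unfolding curv_tensor_def
  by (intro linear_compose_sub linear_N_dir linear_N_family linear_\<Gamma>_left smooth_\<Gamma>)

lemma linear_Rm2: "x \<in> S \<Longrightarrow> linear (\<lambda>b. Rm x a b c)"
  unfolding curv_tensor_def
  by (intro linear_compose_sub linear_N_dir linear_N_family linear_\<Gamma>_left smooth_\<Gamma>)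

lemma linear_Rm3: "x \<in> S \<Longrightarrow> linear (\<lambda>c. Rm x a b c)"
  unfolding curv_tensor_def
  by (intro linear_compose_sub linear_N_family linear_\<Gamma>_right smooth_\<Gamma>)

lemmas Rm_add = linear_add[OF linear_Rm1] linear_add[OF linear_Rm2] linear_add[OF linear_Rm3]

context
  fixes a b c :: "'n vfield"
  assumes a: "smooth_on S a" and b: "smooth_on S b" and c: "smooth_on S c"
begin

lemma smooth_Rm3: "smooth_on S (\<lambda>y. Rm y u v (c y))"
  using smooth_on_apply[OF S linear_Rm3 smooth_Rm_const c] .

lemma smooth_Rm2: "smooth_on S (\<lambda>y. Rm y u (b y) (c y))"
  by (rule smooth_on_apply[OF S linear_Rm2 smooth_Rm3 b])

lemma smooth_Rm: "smooth_on S (\<lambda>y. Rm y (a y) (b y) (c y))"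
  by (rule smooth_on_apply[OF S linear_Rm1 smooth_Rm2 a])

lemma N_Rm:
  assumes x: "x \<in> S"
  shows "N v (\<lambda>y. Rm y (a y) (b y) (c y)) x = nabla_curv_tensor G x v (a x) (b x) (c x)
    + Rm x (N v a x) (b x) (c x) + Rm x (a x) (N v b x) (c x) + Rm x (a x) (b x) (N v c x)"
  unfolding N_apply[OF x linear_Rm1 smooth_Rm2 a, simplified]
    N_apply[OF x linear_Rm2 smooth_Rm3 b, simplified]
    N_apply[OF x linear_Rm3 smooth_Rm_const c, simplified]
  by (simp add: nabla_curv_tensor_def cov_deriv_def[of G v a] cov_deriv_def[of G v b]
      cov_deriv_def[of G v c] Rm_add[OF x])

end

abbreviation "nR \<equiv> nabla_curv_tensor G"

lemma nabla_curvature_eq_nR: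
  assumes x: "x \<in> S"
    and V: "smooth_on S V" and X: "smooth_on S X" and Y: "smooth_on S Y" and Z: "smooth_on S Z"
  shows "nabla_curvature G V X Y Z x = nR x (V x) (X x) (Y x) (Z x)"
proof -
  have N: "smooth_on S (levi_civita G V Z)" if "smooth_on S Z" for Z
    unfolding levi_civita_eq_N[abs_def]
    by (rule smooth_on_apply[OF S linear_N_dir[OF _ that] smooth_N[OF that] V])
  have "levi_civita G V (curvature G X Y Z) x = N (V x) (\<lambda>y. Rm y (X y) (Y y) (Z y)) x"
    unfolding levi_civita_eq_N by (rule N_cong[OF x]) (rule curvature_eq_Rm[OF _ X Y Z])
  then show ?thesis
    unfolding nabla_curvature_def curvature_eq_Rm[OF x N[OF X] Y Z] curvature_eq_Rm[OF x X N[OF Y] Z]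
      curvature_eq_Rm[OF x X Y N[OF Z]]
    by (simp add: N_Rm[OF X Y Z x] levi_civita_eq_N)
qed

lemma N_zero [simp]: "N v (\<lambda>_. 0) x = 0"
  by (simp add: cov_deriv_def linear_0[OF linear_\<Gamma>_right])

lemma N_eq_zero: "x \<in> S \<Longrightarrow> (\<And>y. y \<in> S \<Longrightarrow> Z y = 0) \<Longrightarrow> N v Z x = 0"
  using N_cong[of x Z "\<lambda>_. 0" v] by simp

lemma N_Rm_const:
  assumes "x \<in> S"
  shows "N v (\<lambda>y. Rm y a b c) x = nR x v a b c
    + Rm x (\<Gamma> x v a) b c + Rm x a (\<Gamma> x v b) c + Rm x a b (\<Gamma> x v c)"
  by (simp add: nabla_curv_tensor_def)

section \<open>Symmetries and Bianchi identities\<close>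

lemma Rm_skew: "Rm x a b c = - Rm x b a c"
  by (simp add: curv_tensor_def)

lemma Rm_bianchi:
  assumes x: "x \<in> S"
  shows "Rm x a b c + Rm x b c a + Rm x c a b = 0"
proof -
  have "N u (\<lambda>y. \<Gamma> y v w) x = N u (\<lambda>y. \<Gamma> y w v) x" for u v w
    by (rule N_cong[OF x \<Gamma>_sym])
  from this[of a b c] this[of b a c] this[of c a b] show ?thesis
    by (simp add: curv_tensor_def)
qed

text \<open>The pattern for all algebraic symmetries of the derivative: differentiate the identity
  for \<open>Rm\<close>; the Christoffel corrections are themselves instances of that
  identity.\<close>

lemma nR_skew:
  assumes x: "x \<in> S"
  shows "nR x v a b c = - nR x v b a c"
proof -
  have "N v (\<lambda>y. Rm y a b c + Rm y b a c) x = 0"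
    by (rule N_eq_zero[OF x]) (simp add: Rm_skew[of _ a b])
  then have "N v (\<lambda>y. Rm y a b c) x + N v (\<lambda>y. Rm y b a c) x = 0"
    using N_add[OF x smooth_Rm_const smooth_Rm_const] by simp
  then show ?thesis
    unfolding N_Rm_const[OF x] Rm_skew[of x b a] Rm_skew[of x b "\<Gamma> x v a"] Rm_skew[of x "\<Gamma> x v b" a]
    by (simp add: add_eq_0_iff2)
qed

lemma nR_bianchi1:
  assumes x: "x \<in> S"
  shows "nR x v a b c + nR x v b c a + nR x v c a b = 0"
proof -
  have "N v (\<lambda>y. (Rm y a b c + Rm y b c a) + Rm y c a b) x = 0"
    by (rule N_eq_zero[OF x]) (rule Rm_bianchi)
  then have "N v (\<lambda>y. Rm y a b c) x + N v (\<lambda>y. Rm y b c a) x + N v (\<lambda>y. Rm y c a b) x = 0"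
    using N_add[OF x smooth_on_add[OF S smooth_Rm_const smooth_Rm_const] smooth_Rm_const]
      N_add[OF x smooth_Rm_const smooth_Rm_const] by simp
  moreover note Rm_bianchi[OF x, of "\<Gamma> x v a" b c] Rm_bianchi[OF x, of a "\<Gamma> x v b" c]
    Rm_bianchi[OF x, of a b "\<Gamma> x v c"]
  moreover have "nR x v a b c + nR x v b c a + nR x v c a b =
    (N v (\<lambda>y. Rm y a b c) x + N v (\<lambda>y. Rm y b c a) x + N v (\<lambda>y. Rm y c a b) x)
    - (Rm x (\<Gamma> x v a) b c + Rm x b c (\<Gamma> x v a) + Rm x c (\<Gamma> x v a) b)
    - (Rm x a (\<Gamma> x v b) c + Rm x (\<Gamma> x v b) c a + Rm x c a (\<Gamma> x v b))
    - (Rm x a b (\<Gamma> x v c) + Rm x b (\<Gamma> x v c) a + Rm x (\<Gamma> x v c) a b)"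
    by (simp add: N_Rm_const[OF x])
  ultimately show ?thesis by simp
qed

text \<open>The Jacobi identity for the operators \<open>N a\<close>, \<open>N b\<close>,
  \<open>N c\<close> applied to the constant field \<open>w\<close>: \<open>jac\<close> and
  \<open>com\<close> expand the double commutators, and the other terms cancel because the
  connection is torsion-free.\<close>

lemma nR_bianchi2:
  assumes x: "x \<in> S"
  shows "nR x a b c w + nR x b c a w + nR x c a b w = 0"
proof -
  have jac: "N a (\<lambda>y. Rm y b c w) x = N a (N b (\<lambda>y. \<Gamma> y c w)) x - N a (N c (\<lambda>y. \<Gamma> y b w)) x" for a b c
    unfolding curv_tensor_def by (rule N_diff[OF x smooth_N[OF smooth_\<Gamma>] smooth_N[OF smooth_\<Gamma>]])
  have com: "Rm x b c (\<Gamma> x a w) = N b (N c (\<lambda>y. \<Gamma> y a w)) x - N c (N b (\<lambda>y. \<Gamma> y a w)) x" for a b c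
    by (rule N_N_commute[OF x smooth_\<Gamma>, symmetric])
  have q: "Rm x (\<Gamma> x a b) c w + Rm x c (\<Gamma> x b a) w = 0" for a b c
    unfolding \<Gamma>_sym[OF x, of b a] Rm_skew[of x c] by simp
  have "nR x a b c w + nR x b c a w + nR x c a b w =
     - (Rm x (\<Gamma> x a b) c w + Rm x c (\<Gamma> x b a) w) - (Rm x (\<Gamma> x b c) a w + Rm x a (\<Gamma> x c b) w)
     - (Rm x (\<Gamma> x c a) b w + Rm x b (\<Gamma> x a c) w)"
    unfolding nabla_curv_tensor_def jac com by simp
  then show ?thesis unfolding q by simp
qed

lemma smooth_\<beta>:
  assumes "smooth_on S Y" "smooth_on S Z"
  shows "smooth_on S (\<lambda>y. \<beta> y (Y y) (Z y))"
proof -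
  have "smooth_on S (\<lambda>y. \<Sum>i\<in>UNIV. Y y $ i * (\<Sum>j\<in>UNIV. G y $ i $ j * Z y $ j))"
    by (intro smooth_on_sum[OF S] smooth_on_mult[OF S] smooth_on_nth[OF S] G assms)
  then show ?thesis by (simp add: bilin_def inner_vec_def matrix_vector_mult_def)
qed

lemma dir_deriv_\<beta>:
  assumes "x \<in> S" "smooth_on S Y" "smooth_on S Z"
  shows "dir_deriv v (\<lambda>y. \<beta> y (Y y) (Z y)) x = \<beta> x (N v Y x) (Z x) + \<beta> x (Y x) (N v Z x)"
  using levi_civita_metric[OF S assms(1) smooth_on_differentiable[OF G assms(1)] symG invG[OF assms(1)]
    smooth_on_differentiable[OF assms(2,1)] smooth_on_differentiable[OF assms(3,1)], of "\<lambda>_. v"]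
  by (simp add: levi_civita_eq_N)

text \<open>Second derivatives of the function \<open>\<beta> y w z\<close> commute. In their
  expansion the products of first covariant derivatives are symmetric in \<open>u\<close> and
  \<open>v\<close>, so only commutators remain.\<close>

lemma Rm_metric:
  assumes x: "x \<in> S"
  shows "\<beta> x (Rm x u v w) z = - \<beta> x w (Rm x u v z)"
proof -
  let ?W = "\<lambda>_::real ^ 'n. w" and ?Z = "\<lambda>_::real ^ 'n. z"
  have *: "dir_deriv u (dir_deriv v (\<lambda>y. \<beta> y w z)) x =
      \<beta> x (N u (N v ?W) x) z + \<beta> x (N v ?W x) (N u ?Z x)
      + (\<beta> x (N u ?W x) (N v ?Z x) + \<beta> x w (N u (N v ?Z) x))" for u v
  proof -
    have "dir_deriv u (dir_deriv v (\<lambda>y. \<beta> y w z)) x =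
        dir_deriv u (\<lambda>y. \<beta> y (N v ?W y) z + \<beta> y w (N v ?Z y)) x"
      by (rule dir_deriv_cong[OF S x]) (rule dir_deriv_\<beta>[OF _ smooth_on_const smooth_on_const])
    also have "\<dots> = dir_deriv u (\<lambda>y. \<beta> y (N v ?W y) z) x + dir_deriv u (\<lambda>y. \<beta> y w (N v ?Z y)) x"
      by (rule dir_deriv_eq[OF has_derivative_add]; rule smooth_on_has_derivative[OF smooth_\<beta> x])
        (intro smooth_N smooth_on_const)+
    also have "dir_deriv u (\<lambda>y. \<beta> y (N v ?W y) z) x =
        \<beta> x (N u (N v ?W) x) z + \<beta> x (N v ?W x) (N u ?Z x)"
      by (rule dir_deriv_\<beta>[OF x smooth_N[OF smooth_on_const] smooth_on_const])
    also have "dir_deriv u (\<lambda>y. \<beta> y w (N v ?Z y)) x =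
        \<beta> x (N u ?W x) (N v ?Z x) + \<beta> x w (N u (N v ?Z) x)"
      by (rule dir_deriv_\<beta>[OF x smooth_on_const smooth_N[OF smooth_on_const]])
    finally show ?thesis .
  qed
  have "\<beta> x (N u (N v ?W) x - N v (N u ?W) x) z + \<beta> x w (N u (N v ?Z) x - N v (N u ?Z) x) = 0"
    using dir_deriv_commute_real[where u = u and v = v and f = "\<lambda>y. \<beta> y w z", OF S x
        smooth_\<beta>[OF smooth_on_const smooth_on_const]]
    unfolding * by (simp add: bilin_diff_left bilin_diff_right)
  then show ?thesis
    using N_N_commute[OF x smooth_on_const, of u v w] N_N_commute[OF x smooth_on_const, of u v z] by simp
qed

lemma nR_metric:
  assumes x: "x \<in> S"
  shows "\<beta> x (nR x v a b c) d = - \<beta> x c (nR x v a b d)"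
proof -
  have "dir_deriv v (\<lambda>y. \<beta> y (Rm y a b c) d + \<beta> y c (Rm y a b d)) x = dir_deriv v (\<lambda>_. 0) x"
    by (rule dir_deriv_cong[OF S x]) (simp add: Rm_metric)
  moreover have "dir_deriv v (\<lambda>y. \<beta> y (Rm y a b c) d + \<beta> y c (Rm y a b d)) x =
     dir_deriv v (\<lambda>y. \<beta> y (Rm y a b c) d) x + dir_deriv v (\<lambda>y. \<beta> y c (Rm y a b d)) x"
    by (rule dir_deriv_eq[OF has_derivative_add]; rule smooth_on_has_derivative[OF smooth_\<beta> x])
      (intro smooth_Rm_const smooth_on_const)+
  ultimately have "\<beta> x (N v (\<lambda>y. Rm y a b c) x) d + \<beta> x (Rm x a b c) (\<Gamma> x v d)
      + (\<beta> x (\<Gamma> x v c) (Rm x a b d) + \<beta> x c (N v (\<lambda>y. Rm y a b d) x)) = 0"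
    using dir_deriv_\<beta>[OF x smooth_Rm_const smooth_on_const] dir_deriv_\<beta>[OF x smooth_on_const smooth_Rm_const]
    by (simp add: N_const)
  then show ?thesis
    unfolding N_Rm_const[OF x]
    using Rm_metric[OF x, of a b c "\<Gamma> x v d"] Rm_metric[OF x, of a b "\<Gamma> x v c" d]
      Rm_metric[OF x, of "\<Gamma> x v a" b c d] Rm_metric[OF x, of a "\<Gamma> x v b" c d]
    by (simp add: bilin_add_left bilin_add_right)
qed

section \<open>Semi-symmetry at a point and its derivative\<close>

definition semi_symmetric_at :: "real ^ 'n \<Rightarrow> bool" where
  "semi_symmetric_at x \<longleftrightarrow> (\<forall>a b c d e. Rm x a b (Rm x c d e) - Rm x c d (Rm x a b e) =
     Rm x (Rm x a b c) d e + Rm x c (Rm x a b d) e)"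

text \<open>The Ricci identity: \<open>R \<cdot> R\<close> is the antisymmetrised second covariant derivative of \<open>R\<close>.\<close>

lemma parallel_imp_semi_symmetric:
  assumes par: "\<And>y v a b c. y \<in> S \<Longrightarrow> nR y v a b c = 0" and x: "x \<in> S"
  shows "semi_symmetric_at x"
  unfolding semi_symmetric_at_def
proof (intro allI)
  fix u v a b c
  let ?A = "\<lambda>y. Rm y a b c"
  \<comment> \<open>The three bracketed groups are symmetric in \<open>u\<close> and
    \<open>v\<close> and drop out of the commutator. In the remaining terms, antisymmetrising the
    derivative of the Christoffel map gives \<open>Rm\<close>, as recorded in
    \<open>d\<close>.\<close>
  have *: "N u (N v ?A) x = Rm x (N u (\<lambda>y. \<Gamma> y v a) x) b c + Rm x a (N u (\<lambda>y. \<Gamma> y v b) x) c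
      + Rm x a b (N u (\<lambda>y. \<Gamma> y v c) x)
      + (Rm x (\<Gamma> x v a) (\<Gamma> x u b) c + Rm x (\<Gamma> x u a) (\<Gamma> x v b) c)
      + (Rm x (\<Gamma> x v a) b (\<Gamma> x u c) + Rm x (\<Gamma> x u a) b (\<Gamma> x v c))
      + (Rm x a (\<Gamma> x v b) (\<Gamma> x u c) + Rm x a (\<Gamma> x u b) (\<Gamma> x v c))" for u v
  proof -
    have "N u (N v ?A) x =
        N u (\<lambda>y. Rm y (\<Gamma> y v a) b c + Rm y a (\<Gamma> y v b) c + Rm y a b (\<Gamma> y v c)) x"
      by (rule N_cong[OF x]) (simp add: N_Rm_const par)
    also have "\<dots> = N u (\<lambda>y. Rm y (\<Gamma> y v a) b c) x + N u (\<lambda>y. Rm y a (\<Gamma> y v b) c) x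
        + N u (\<lambda>y. Rm y a b (\<Gamma> y v c)) x"
      using N_add[OF x smooth_on_add[OF S smooth_Rm smooth_Rm] smooth_Rm] N_add[OF x smooth_Rm smooth_Rm]
        smooth_\<Gamma> smooth_on_const by simp
    also have "N u (\<lambda>y. Rm y (\<Gamma> y v a) b c) x = Rm x (N u (\<lambda>y. \<Gamma> y v a) x) b c
        + Rm x (\<Gamma> x v a) (\<Gamma> x u b) c + Rm x (\<Gamma> x v a) b (\<Gamma> x u c)"
      using N_Rm[OF smooth_\<Gamma> smooth_on_const smooth_on_const x] by (simp add: par[OF x] N_const)
    also have "N u (\<lambda>y. Rm y a (\<Gamma> y v b) c) x = Rm x (\<Gamma> x u a) (\<Gamma> x v b) c
        + Rm x a (N u (\<lambda>y. \<Gamma> y v b) x) c + Rm x a (\<Gamma> x v b) (\<Gamma> x u c)"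
      using N_Rm[OF smooth_on_const smooth_\<Gamma> smooth_on_const x] by (simp add: par[OF x] N_const)
    also have "N u (\<lambda>y. Rm y a b (\<Gamma> y v c)) x = Rm x (\<Gamma> x u a) b (\<Gamma> x v c)
        + Rm x a (\<Gamma> x u b) (\<Gamma> x v c) + Rm x a b (N u (\<lambda>y. \<Gamma> y v c) x)"
      using N_Rm[OF smooth_on_const smooth_on_const smooth_\<Gamma> x] by (simp add: par[OF x] N_const)
    finally show ?thesis by simp
  qed
  have d: "N u (\<lambda>y. \<Gamma> y v p) x = Rm x u v p + N v (\<lambda>y. \<Gamma> y u p) x" for p
    by (simp add: curv_tensor_def)
  show "Rm x u v (Rm x a b c) - Rm x a b (Rm x u v c) = Rm x (Rm x u v a) b c + Rm x a (Rm x u v b) c"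
    using N_N_commute[OF x smooth_Rm_const, of u v a b c, symmetric]
    unfolding *[of u v] *[of v u] d Rm_add[OF x] by simp
qed

text \<open>The Leibniz rule applied to an expression quadratic in the curvature: its polarisation,
  with one factor replaced by the covariant derivative, vanishes too.\<close>

lemma semi_symmetric_derivative:
  assumes semi: "\<And>y. y \<in> S \<Longrightarrow> semi_symmetric_at y" and x: "x \<in> S"
  shows "nR x v a b (Rm x c d e) + Rm x a b (nR x v c d e)
      - nR x v c d (Rm x a b e) - Rm x c d (nR x v a b e) =
    nR x v (Rm x a b c) d e + Rm x (nR x v a b c) d e
      + nR x v c (Rm x a b d) e + Rm x c (nR x v a b d) e"
proof -
  define E where "E a b c d e y = (Rm y a b (Rm y c d e) - Rm y c d (Rm y a b e)) -
     (Rm y (Rm y a b c) d e + Rm y c (Rm y a b d) e)" for a b c d e y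
  have E0: "E a b c d e y = 0" if "y \<in> S" for a b c d e y
    using semi[OF that] unfolding E_def semi_symmetric_at_def by simp
  note sm = smooth_Rm[OF smooth_on_const smooth_on_const smooth_Rm_const]
    smooth_Rm[OF smooth_Rm_const smooth_on_const smooth_on_const]
    smooth_Rm[OF smooth_on_const smooth_Rm_const smooth_on_const]
  have "N v (\<lambda>y. E a b c d e y) x = (N v (\<lambda>y. Rm y a b (Rm y c d e)) x - N v (\<lambda>y. Rm y c d (Rm y a b e)) x)
     - (N v (\<lambda>y. Rm y (Rm y a b c) d e) x + N v (\<lambda>y. Rm y c (Rm y a b d) e) x)"
    unfolding E_def N_diff[OF x smooth_on_diff[OF S sm(1) sm(1)] smooth_on_add[OF S sm(2) sm(3)]]
      N_diff[OF x sm(1) sm(1)] N_add[OF x sm(2) sm(3)] ..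
  moreover have "N v (\<lambda>y. E a b c d e y) x = 0"
    by (rule N_eq_zero[OF x]) (rule E0)
  \<comment> \<open>These are the Christoffel corrections of the five constant arguments; each is
    again an instance of semi-symmetry at \<open>x\<close>.\<close>
  moreover have "E (\<Gamma> x v a) b c d e x + E a (\<Gamma> x v b) c d e x + E a b (\<Gamma> x v c) d e x
      + E a b c (\<Gamma> x v d) e x + E a b c d (\<Gamma> x v e) x = 0"
    by (simp add: E0[OF x])
  ultimately show ?thesis
    unfolding N_Rm[OF smooth_on_const smooth_on_const smooth_Rm_const x]
      N_Rm[OF smooth_Rm_const smooth_on_const smooth_on_const x]
      N_Rm[OF smooth_on_const smooth_Rm_const smooth_on_const x]
      N_const N_Rm_const[OF x] Rm_add[OF x] E_def
    by (simp add: algebra_simps)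
qed

lemma Rm_trace:
  assumes x: "x \<in> S" and ein: "ricci_operator G x = mat r"
  shows "(\<Sum>k\<in>UNIV. Rm x (axis k 1) u w $ k) = r * \<beta> x u w"
proof -
  have "G x ** matrix_inv (G x) = mat 1"
    using someI_ex[OF invG[OF x, unfolded invertible_def], folded matrix_inv_def] by blast
  then have "ricci G x = G x ** mat r"
    unfolding ein[symmetric] ricci_operator_def by (simp add: matrix_mul_assoc)
  then have "ricci G x $ i $ j = r * G x $ i $ j" for i j
    by (simp add: matrix_matrix_mult_def mat_def if_distrib cong: if_cong)
  moreover have "ricci G x $ i $ j = (\<Sum>k\<in>UNIV. Rm x (axis k 1) (axis i 1) (axis j 1) $ k)" for i j
    by (simp add: ricci_def curvature_eq_Rm[OF x] coord_field_def)
  moreover have "\<beta> x (axis i 1) (axis j 1) = G x $ i $ j" for i j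
    by (simp add: bilin_def inner_axis' matrix_vector_mul_component inner_axis)
  ultimately have ax: "(\<Sum>k\<in>UNIV. Rm x (axis k 1) (axis i 1) (axis j 1) $ k) = r * \<beta> x (axis i 1) (axis j 1)" for i j
    by simp
  have l1: "linear (\<lambda>u. \<Sum>k\<in>UNIV. Rm x (axis k 1) u w $ k)" for w
    using Rm_add[OF x] linear_scale[OF linear_Rm2[OF x]]
    by (intro linearI) (simp_all add: sum.distrib sum_distrib_left)
  have l2: "linear (\<lambda>w. \<Sum>k\<in>UNIV. Rm x (axis k 1) u w $ k)" for u
    using Rm_add[OF x] linear_scale[OF linear_Rm3[OF x]]
    by (intro linearI) (simp_all add: sum.distrib sum_distrib_left)
  have l3: "linear (\<lambda>u. r * \<beta> x u w)" "linear (\<lambda>w. r * \<beta> x u w)" for u w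
    by (intro linearI; simp add: bilin_add_left bilin_add_right bilin_scaleR_left bilin_scaleR_right algebra_simps)+
  show ?thesis
    by (rule linear_eq_on_axes[OF l1 l3(1)], rule linear_eq_on_axes[OF l2 l3(2)], rule ax)
qed

text \<open>The Ricci tensor is the constant \<open>r\<close> times the metric, and the metric is
  parallel.\<close>

lemma nR_trace:
  assumes x: "x \<in> S" and ein: "\<And>y. y \<in> S \<Longrightarrow> ricci_operator G y = mat r"
  shows "(\<Sum>k\<in>UNIV. nR x v (axis k 1) u w $ k) = 0"
proof -
  have d: "dir_deriv v (\<lambda>y. Rm y (axis k 1) u w $ k) x = dir_deriv v (\<lambda>y. Rm y (axis k 1) u w) x $ k" for k
    by (rule dir_deriv_nth[OF smooth_on_differentiable[OF smooth_Rm_const x]])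
  have "((\<lambda>y. \<Sum>k\<in>UNIV. Rm y (axis k 1) u w $ k) has_derivative
     (\<lambda>v. \<Sum>k\<in>UNIV. dir_deriv v (\<lambda>y. Rm y (axis k 1) u w $ k) x)) (at x)"
    by (intro has_derivative_sum smooth_on_has_derivative[OF _ x] smooth_on_nth[OF S] smooth_Rm_const)
  then have "(\<Sum>k\<in>UNIV. dir_deriv v (\<lambda>y. Rm y (axis k 1) u w) x $ k) =
      dir_deriv v (\<lambda>y. \<Sum>k\<in>UNIV. Rm y (axis k 1) u w $ k) x"
    by (simp add: dir_deriv_eq d)
  also have "\<dots> = dir_deriv v (\<lambda>y. r * \<beta> y u w) x"
    by (rule dir_deriv_cong[OF S x]) (rule Rm_trace[OF _ ein])
  also have "\<dots> = r * dir_deriv v (\<lambda>y. \<beta> y u w) x"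
    by (rule dir_deriv_linear[OF bounded_linear_mult_right])
      (rule smooth_on_differentiable[OF smooth_\<beta>[OF smooth_on_const smooth_on_const] x])
  also have "\<dots> = r * \<beta> x (\<Gamma> x v u) w + r * \<beta> x u (\<Gamma> x v w)"
    using dir_deriv_\<beta>[OF x smooth_on_const smooth_on_const] by (simp add: N_const distrib_left)
  finally have "(\<Sum>k\<in>UNIV. dir_deriv v (\<lambda>y. Rm y (axis k 1) u w) x $ k) =
    (\<Sum>k\<in>UNIV. Rm x (axis k 1) (\<Gamma> x v u) w $ k) + (\<Sum>k\<in>UNIV. Rm x (axis k 1) u (\<Gamma> x v w) $ k)"
    using Rm_trace[OF x ein] x by simp
  \<comment> \<open>The correction of the output vector cancels against that of the first argument,
    over which the trace runs.\<close>
  moreover have "(\<Sum>k\<in>UNIV. \<Gamma> x v (Rm x (axis k 1) u w) $ k) = (\<Sum>k\<in>UNIV. Rm x (\<Gamma> x v (axis k 1)) u w $ k)"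
    by (rule trace_commute[OF linear_\<Gamma>_right linear_Rm1[OF x]])
  ultimately show ?thesis
    by (simp add: nabla_curv_tensor_def cov_deriv_def sum.distrib sum_subtractf)
qed

lemma linear_nR0: "x \<in> S \<Longrightarrow> linear (\<lambda>v. nR x v a b c)"
  unfolding nabla_curv_tensor_def
  by (intro linear_compose_sub linear_N_dir smooth_Rm_const
      linear_compose[OF linear_\<Gamma>_left linear_Rm1, unfolded o_def]
      linear_compose[OF linear_\<Gamma>_left linear_Rm2, unfolded o_def]
      linear_compose[OF linear_\<Gamma>_left linear_Rm3, unfolded o_def])

lemma linear_nR1: "x \<in> S \<Longrightarrow> linear (\<lambda>a. nR x v a b c)"
  unfolding nabla_curv_tensor_def
  by (intro linear_compose_sub linear_N_family linear_Rm1 smooth_Rm_const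
      linear_compose[OF linear_\<Gamma>_right linear_Rm1, unfolded o_def])

lemma linear_nR2: "x \<in> S \<Longrightarrow> linear (\<lambda>b. nR x v a b c)"
  unfolding nabla_curv_tensor_def
  by (intro linear_compose_sub linear_N_family linear_Rm2 smooth_Rm_const
      linear_compose[OF linear_\<Gamma>_right linear_Rm2, unfolded o_def])

lemma linear_nR3: "x \<in> S \<Longrightarrow> linear (\<lambda>c. nR x v a b c)"
  unfolding nabla_curv_tensor_def
  by (intro linear_compose_sub linear_N_family linear_Rm3 smooth_Rm_const
      linear_compose[OF linear_\<Gamma>_right linear_Rm3, unfolded o_def])

text \<open>By tensoriality only the values of the fields at a point matter, and constant fields
  realise all of them.\<close>

lemma semi_symmetric_iff:
  "(\<forall>X Y Z T W. smooth_on S X \<and> smooth_on S Y \<and> smooth_on S Z \<and> smooth_on S T \<and> smooth_on S W \<longrightarrow>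
     (\<forall>x\<in>S. curvature G X Y (curvature G Z T W) x - curvature G Z T (curvature G X Y W) x =
       curvature G (curvature G X Y Z) T W x + curvature G Z (curvature G X Y T) W x)) \<longleftrightarrow>
   (\<forall>x\<in>S. semi_symmetric_at x)"
  (is "(\<forall>X Y Z T W. ?smooth X Y Z T W \<longrightarrow> (\<forall>x\<in>S. ?P X Y Z T W x)) \<longleftrightarrow> _")
proof -
  have sm: "smooth_on S (curvature G X Y Z)" if "smooth_on S X" "smooth_on S Y" "smooth_on S Z" for X Y Z
    by (rule smooth_on_transform[OF smooth_Rm[OF that] S]) (rule curvature_eq_Rm[OF _ that])
  have P: "?P X Y Z T W x \<longleftrightarrow>
      Rm x (X x) (Y x) (Rm x (Z x) (T x) (W x)) - Rm x (Z x) (T x) (Rm x (X x) (Y x) (W x)) =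
      Rm x (Rm x (X x) (Y x) (Z x)) (T x) (W x) + Rm x (Z x) (Rm x (X x) (Y x) (T x)) (W x)"
    if "?smooth X Y Z T W" "x \<in> S" for X Y Z T W x
    using that sm by (simp add: curvature_eq_Rm)
  show ?thesis
  proof
    assume *: "\<forall>X Y Z T W. ?smooth X Y Z T W \<longrightarrow> (\<forall>x\<in>S. ?P X Y Z T W x)"
    show "\<forall>x\<in>S. semi_symmetric_at x"
      unfolding semi_symmetric_at_def
    proof (intro ballI allI)
      fix x a b c d e assume "x \<in> S"
      then show "Rm x a b (Rm x c d e) - Rm x c d (Rm x a b e) = Rm x (Rm x a b c) d e + Rm x c (Rm x a b d) e"
        using *[rule_format, of "\<lambda>_. a" "\<lambda>_. b" "\<lambda>_. c" "\<lambda>_. d" "\<lambda>_. e" x]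
          P[of "\<lambda>_. a" "\<lambda>_. b" "\<lambda>_. c" "\<lambda>_. d" "\<lambda>_. e" x] by simp
    qed
  next
    assume "\<forall>x\<in>S. semi_symmetric_at x"
    then show "\<forall>X Y Z T W. ?smooth X Y Z T W \<longrightarrow> (\<forall>x\<in>S. ?P X Y Z T W x)"
      using P unfolding semi_symmetric_at_def by (intro allI impI ballI) simp
  qed
qed

lemma locally_symmetric_iff:
  "(\<forall>V X Y Z. smooth_on S V \<and> smooth_on S X \<and> smooth_on S Y \<and> smooth_on S Z \<longrightarrow>
     (\<forall>x\<in>S. nabla_curvature G V X Y Z x = 0)) \<longleftrightarrow>
   (\<forall>x\<in>S. \<forall>v a b c. nR x v a b c = 0)"
proof
  assume *: "\<forall>V X Y Z. smooth_on S V \<and> smooth_on S X \<and> smooth_on S Y \<and> smooth_on S Z \<longrightarrow>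
     (\<forall>x\<in>S. nabla_curvature G V X Y Z x = 0)"
  show "\<forall>x\<in>S. \<forall>v a b c. nR x v a b c = 0"
  proof (intro ballI allI)
    fix x v a b c assume "x \<in> S"
    then show "nR x v a b c = 0"
      using *[rule_format, of "\<lambda>_. v" "\<lambda>_. a" "\<lambda>_. b" "\<lambda>_. c" x]
      by (simp add: nabla_curvature_eq_nR)
  qed
qed (simp add: nabla_curvature_eq_nR)

end

section \<open>Self-dual part of an Einstein curvature tensor\<close>

definition sg :: "4 \<Rightarrow> real" where "sg i = (if i = 1 \<or> i = 2 then 1 else -1)"

lemma sg_simps [simp]: "sg 1 = 1" "sg 2 = 1" "sg 3 = -1" "sg 4 = -1"
  by (simp_all add: sg_def)

definition sg3 :: "3 \<Rightarrow> real" where "sg3 i = (if i = 1 then -1 else 1)"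

lemma sg3_simps [simp]: "sg3 1 = -1" "sg3 2 = 1" "sg3 3 = 1"
  by (simp_all add: sg3_def)

text \<open>Here \<open>R i j k m\<close> stands for \<open>g(R(e_i, e_j) e_k, e_m)\<close> in a
  pseudo-orthonormal frame with signs \<open>sg\<close>; the last clause says that the Ricci tensor
  is \<open>l\<close> times the metric.\<close>

definition curv_array :: "real \<Rightarrow> (4 \<Rightarrow> 4 \<Rightarrow> 4 \<Rightarrow> 4 \<Rightarrow> real) \<Rightarrow> bool" where
  "curv_array l R \<longleftrightarrow>
     (\<forall>i j k m. R i j k m = - R j i k m \<and> R i j k m = - R i j m k \<and>
        R i j k m + R j k i m + R k i j m = 0) \<and>
     (\<forall>i j. (\<Sum>k\<in>UNIV. sg k * R k i j k) = (if i = j then l * sg i else 0))"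

lemma curv_array_antisym:
  assumes "curv_array l R"
  shows "R i i k m = 0" "R i j k k = 0"
    "R 2 1 k m = - R 1 2 k m" "R 3 1 k m = - R 1 3 k m" "R 4 1 k m = - R 1 4 k m"
    "R 3 2 k m = - R 2 3 k m" "R 4 2 k m = - R 2 4 k m" "R 4 3 k m = - R 3 4 k m"
    "R i j 2 1 = - R i j 1 2" "R i j 3 1 = - R i j 1 3" "R i j 4 1 = - R i j 1 4"
    "R i j 3 2 = - R i j 2 3" "R i j 4 2 = - R i j 2 4" "R i j 4 3 = - R i j 3 4"
proof -
  have a: "R i j k m = - R j i k m" "R i j k m = - R i j m k" for i j k m
    using assms unfolding curv_array_def by blast+
  show "R i i k m = 0" "R i j k k = 0"
    using a(1)[of i i k m] a(2)[of i j k k] by simp_all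
qed (use assms in \<open>unfold curv_array_def, blast\<close>)+

text \<open>A linear combination of the four cyclic identities on the indices; the many instances of
  antisymmetry only bring the terms to a common order.\<close>

lemma curv_array_pair:
  assumes "curv_array l R"
  shows "R i j k m = R k m i j"
proof -
  have a: "R i j k m = - R j i k m" "R i j k m = - R i j m k" "R i j k m + R j k i m + R k i j m = 0" for i j k m
    using assms unfolding curv_array_def by blast+
  show ?thesis
    using a(3)[of i j k m] a(3)[of j k m i] a(3)[of k m i j] a(3)[of m i j k]
      a[of i j k m] a[of j k m i] a[of k m i j] a[of m i j k] a[of i k m j] a[of j m i k]
      a[of k i m j] a[of k i j m] a[of j k i m] a[of m j k i] a[of m i k j] a[of m j i k] a[of j m k i] a[of i k j m] a[of m k i j]
      a[of i m j k] a[of k j i m] a[of k j m i] a[of i m k j]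
    by linarith
qed

text \<open>Oriented as rewrite rules to a normal form: modulo antisymmetry, everything becomes
  linear in \<open>l\<close> and ten components, as many as a Weyl tensor has in dimension
  four.\<close>

lemma curv_array_einstein:
  assumes "curv_array l R"
  shows "R 3 4 3 4 = R 1 2 1 2" "R 2 4 2 4 = R 1 3 1 3" "R 2 3 2 3 = l + R 1 2 1 2 - R 1 3 1 3"
    "R 1 4 1 4 = l + R 1 2 1 2 - R 1 3 1 3" "R 1 4 2 4 = - R 1 3 2 3" "R 1 4 3 4 = - R 1 2 2 3"
    "R 1 3 3 4 = R 1 2 2 4" "R 2 4 3 4 = R 1 2 1 3" "R 2 3 3 4 = - R 1 2 1 4"
    "R 2 3 2 4 = - R 1 3 1 4" "R 1 2 3 4 = R 1 3 2 4 - R 1 4 2 3"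
    "R 1 3 1 2 = R 1 2 1 3" "R 1 4 1 2 = R 1 2 1 4" "R 2 3 1 2 = R 1 2 2 3" "R 2 4 1 2 = R 1 2 2 4"
    "R 3 4 1 2 = R 1 3 2 4 - R 1 4 2 3"
    "R 1 4 1 3 = R 1 3 1 4" "R 2 3 1 3 = R 1 3 2 3" "R 2 4 1 3 = R 1 3 2 4" "R 3 4 1 3 = R 1 2 2 4"
    "R 2 3 1 4 = R 1 4 2 3" "R 2 4 1 4 = - R 1 3 2 3" "R 3 4 1 4 = - R 1 2 2 3"
    "R 2 4 2 3 = - R 1 3 1 4" "R 3 4 2 3 = - R 1 2 1 4" "R 3 4 2 4 = R 1 2 1 3"
proof -
  note s = curv_array_antisym[OF assms]
  have r: "(\<Sum>k\<in>UNIV. sg k * R k i j k) = (if i = j then l * sg i else 0)" for i j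
    using assms unfolding curv_array_def by blast
  note p = curv_array_pair[OF assms]
  have b: "R 1 2 3 4 + R 2 3 1 4 + R 3 1 2 4 = 0"
    using assms unfolding curv_array_def by blast
  note e = r[of 1 1] r[of 2 2] r[of 3 3] r[of 4 4] r[of 1 2] r[of 1 3] r[of 1 4] r[of 2 3] r[of 2 4] r[of 3 4] b
  note p' = p[of 1 3 1 2] p[of 1 4 1 2] p[of 2 3 1 2] p[of 2 4 1 2] p[of 3 4 1 2] p[of 1 4 1 3] p[of 2 3 1 3]
    p[of 2 4 1 3] p[of 3 4 1 3] p[of 2 3 1 4] p[of 2 4 1 4] p[of 3 4 1 4] p[of 2 4 2 3] p[of 3 4 2 3] p[of 3 4 2 4]
  note e' = e[unfolded sum_4 s, simplified]
  show "R 3 4 3 4 = R 1 2 1 2" "R 2 4 2 4 = R 1 3 1 3" "R 2 3 2 3 = l + R 1 2 1 2 - R 1 3 1 3"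
    "R 1 4 1 4 = l + R 1 2 1 2 - R 1 3 1 3" "R 1 4 2 4 = - R 1 3 2 3" "R 1 4 3 4 = - R 1 2 2 3"
    "R 1 3 3 4 = R 1 2 2 4" "R 2 4 3 4 = R 1 2 1 3" "R 2 3 3 4 = - R 1 2 1 4"
    "R 2 3 2 4 = - R 1 3 1 4" "R 1 2 3 4 = R 1 3 2 4 - R 1 4 2 3"
    "R 1 3 1 2 = R 1 2 1 3" "R 1 4 1 2 = R 1 2 1 4" "R 2 3 1 2 = R 1 2 2 3" "R 2 4 1 2 = R 1 2 2 4"
    "R 3 4 1 2 = R 1 3 2 4 - R 1 4 2 3"
    "R 1 4 1 3 = R 1 3 1 4" "R 2 3 1 3 = R 1 3 2 3" "R 2 4 1 3 = R 1 3 2 4" "R 3 4 1 3 = R 1 2 2 4"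
    "R 2 3 1 4 = R 1 4 2 3" "R 2 4 1 4 = - R 1 3 2 3" "R 3 4 1 4 = - R 1 2 2 3"
    "R 2 4 2 3 = - R 1 3 1 4" "R 3 4 2 3 = - R 1 2 1 4" "R 3 4 2 4 = R 1 2 1 3"
    using e' p' by linarith+
qed

text \<open>With \<open>sg\<close> the signs of an orthonormal basis, \<open>e\<^sub>1\<^sub>2 + e\<^sub>3\<^sub>4\<close>, \<open>e\<^sub>1\<^sub>3 + e\<^sub>2\<^sub>4\<close>, \<open>e\<^sub>1\<^sub>4 - e\<^sub>2\<^sub>3\<close> is a basis of
  the self-dual bivectors; their norms have the signs \<open>- sg3\<close>. The matrix \<open>sd_part R\<close> is the self-dual
  block of the curvature operator with one index lowered.\<close>

definition sd_form :: "(4 \<Rightarrow> 4 \<Rightarrow> 4 \<Rightarrow> 4 \<Rightarrow> real) \<Rightarrow> 3 \<Rightarrow> 4 \<Rightarrow> 4 \<Rightarrow> real" where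
  "sd_form R a i j = (if a = 1 then R 1 2 i j + R 3 4 i j
     else if a = 2 then R 1 3 i j + R 2 4 i j else R 1 4 i j - R 2 3 i j)"

definition sd_part :: "(4 \<Rightarrow> 4 \<Rightarrow> 4 \<Rightarrow> 4 \<Rightarrow> real) \<Rightarrow> 3 \<Rightarrow> 3 \<Rightarrow> real" where
  "sd_part R a b = sd_form R a 1 (if b = 1 then 2 else if b = 2 then 3 else 4)"

lemma sd_form_simps:
  "sd_form R 1 i j = R 1 2 i j + R 3 4 i j"
  "sd_form R 2 i j = R 1 3 i j + R 2 4 i j"
  "sd_form R 3 i j = R 1 4 i j - R 2 3 i j"
  by (simp_all add: sd_form_def)

lemma sd_part_simps:
  "sd_part R a 1 = sd_form R a 1 2" "sd_part R a 2 = sd_form R a 1 3" "sd_part R a 3 = sd_form R a 1 4"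
  by (simp_all add: sd_part_def)

text \<open>The Einstein condition at work: the curvature operator maps a self-dual bivector to a
  self-dual form, so the block mixing the two halves vanishes.\<close>

lemma sd_form_eq_sd_part:
  assumes "curv_array l R"
  shows "sd_form R a 3 4 = sd_part R a 1" "sd_form R a 2 4 = sd_part R a 2" "sd_form R a 2 3 = - sd_part R a 3"
proof -
  have "\<forall>a. sd_form R a 3 4 = sd_part R a 1 \<and> sd_form R a 2 4 = sd_part R a 2 \<and> sd_form R a 2 3 = - sd_part R a 3"
    unfolding forall_3 sd_part_simps sd_form_simps by (simp add: curv_array_einstein[OF assms])
  then show "sd_form R a 3 4 = sd_part R a 1" "sd_form R a 2 4 = sd_part R a 2" "sd_form R a 2 3 = - sd_part R a 3"
    by blast+
qed

lemma sd_part_sym: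
  assumes "curv_array l R"
  shows "sd_part R a b = sd_part R b a"
proof -
  have "\<forall>a b. sd_part R a b = sd_part R b a"
    unfolding forall_3 sd_part_simps sd_form_simps by (simp add: curv_array_einstein[OF assms])
  then show ?thesis by blast
qed

text \<open>The components \<open>R 1 3 2 4\<close> and \<open>R 1 4 2 3\<close> cancel. The trace
  of the block is thus the Einstein constant, a quarter of the scalar curvature.\<close>

lemma sd_part_trace:
  assumes "curv_array l R"
  shows "(\<Sum>a\<in>UNIV. sg3 a * sd_part R a a) = l"
  unfolding sum_3 sd_part_simps sd_form_simps by (simp add: curv_array_einstein[OF assms])

text \<open>The components of \<open>Q \<cdot> R\<close>; semi-symmetry is \<open>curv_act R R = 0\<close>.\<close>

definition curv_act :: "(4 \<Rightarrow> 4 \<Rightarrow> 4 \<Rightarrow> 4 \<Rightarrow> real) \<Rightarrow> (4 \<Rightarrow> 4 \<Rightarrow> 4 \<Rightarrow> 4 \<Rightarrow> real) \<Rightarrow> 4 \<Rightarrow> 4 \<Rightarrow> 4 \<Rightarrow> 4 \<Rightarrow> 4 \<Rightarrow> 4 \<Rightarrow> real" where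
  "curv_act Q R i j k l m n = (\<Sum>x\<in>UNIV. sg x * (R k l m x * Q i j x n - Q i j m x * R k l x n
     - Q i j k x * R x l m n - Q i j l x * R k x m n))"

text \<open>The polarisation of \<open>2 (\<rho>\<^sup>2 - l \<rho> + 2 / 3 \<sigma>)\<close>, with an index lowered.\<close>

definition sd_quadratic :: "real \<Rightarrow> real \<Rightarrow> (3 \<Rightarrow> 3 \<Rightarrow> real) \<Rightarrow> (3 \<Rightarrow> 3 \<Rightarrow> real) \<Rightarrow> 3 \<Rightarrow> 3 \<Rightarrow> real" where
  "sd_quadratic l l' p q a b = (\<Sum>c\<in>UNIV. sg3 c * (p a c * q c b + q a c * p c b)) - l * q a b - l' * p a b
     + 2 / 3 * (l * l' - (\<Sum>c\<in>UNIV. \<Sum>d\<in>UNIV. sg3 c * sg3 d * p c d * q c d)) * (if a = b then sg3 a else 0)"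

text \<open>Being symmetric and bilinear in the two arrays, the identity serves twice: with
  \<open>Q = R\<close> it is the quadratic equation, and with \<open>Q\<close> a derivative of
  \<open>R\<close> and \<open>l' = 0\<close> it is the differentiated equation.\<close>

lemma sd_quadratic_zero:
  assumes R: "curv_array l R" and Q: "curv_array l' Q"
    and semi: "\<And>i j k l m n. curv_act Q R i j k l m n + curv_act R Q i j k l m n = 0"
  shows "sd_quadratic l l' (sd_part R) (sd_part Q) a b = 0"
proof -
  note simps = curv_array_antisym[OF R] curv_array_antisym[OF Q] curv_array_einstein[OF R] curv_array_einstein[OF Q]
  note sm = semi[unfolded curv_act_def sum_4]
  define K where "K = sd_quadratic l l' (sd_part R) (sd_part Q)"
  note def = K_def sd_quadratic_def sum_3 sd_part_simps sd_form_simps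
  \<comment> \<open>The pairs 12, 34 and 13, 24 evaluate the action on the first two self-dual basis
    bivectors; the second row of instances exchanges them, for the antisymmetric part. Their bracket
    is a multiple of the third bivector, whence the index 3, and the final pair 12 reads off the
    index 1. The other entries follow the same scheme.\<close>
  have k13: "K 1 3 = 0"
    using sm[of 1 2 1 3 1 2] sm[of 1 2 2 4 1 2] sm[of 3 4 1 3 1 2] sm[of 3 4 2 4 1 2]
      sm[of 1 3 1 2 1 2] sm[of 1 3 3 4 1 2] sm[of 2 4 1 2 1 2] sm[of 2 4 3 4 1 2]
    by (simp add: simps def algebra_simps)
  have k23: "K 2 3 = 0"
    using sm[of 1 2 1 3 1 3] sm[of 1 2 2 4 1 3] sm[of 3 4 1 3 1 3] sm[of 3 4 2 4 1 3]
      sm[of 1 3 1 2 1 3] sm[of 1 3 3 4 1 3] sm[of 2 4 1 2 1 3] sm[of 2 4 3 4 1 3]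
    by (simp add: simps def algebra_simps)
  have k33: "K 3 3 = 0"
    using sm[of 1 2 1 3 1 4] sm[of 1 2 2 4 1 4] sm[of 3 4 1 3 1 4] sm[of 3 4 2 4 1 4]
      sm[of 1 3 1 2 1 4] sm[of 1 3 3 4 1 4] sm[of 2 4 1 2 1 4] sm[of 2 4 3 4 1 4]
    by (simp add: simps def algebra_simps)
  have k12: "K 1 2 = 0"
    using sm[of 1 2 1 4 1 2] sm[of 1 2 2 3 1 2] sm[of 3 4 1 4 1 2] sm[of 3 4 2 3 1 2]
      sm[of 1 4 1 2 1 2] sm[of 1 4 3 4 1 2] sm[of 2 3 1 2 1 2] sm[of 2 3 3 4 1 2]
    by (simp add: simps def algebra_simps)
  have k22: "K 2 2 = 0"
    using sm[of 1 2 1 4 1 3] sm[of 1 2 2 3 1 3] sm[of 3 4 1 4 1 3] sm[of 3 4 2 3 1 3]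
      sm[of 1 4 1 2 1 3] sm[of 1 4 3 4 1 3] sm[of 2 3 1 2 1 3] sm[of 2 3 3 4 1 3]
    by (simp add: simps def algebra_simps)
  have k11: "K 1 1 = 0"
    using sm[of 1 3 1 4 1 2] sm[of 1 3 2 3 1 2] sm[of 2 4 1 4 1 2] sm[of 2 4 2 3 1 2]
      sm[of 1 4 1 3 1 2] sm[of 1 4 2 4 1 2] sm[of 2 3 1 3 1 2] sm[of 2 3 2 4 1 2]
    by (simp add: simps def algebra_simps)
  have "K b a = K a b" for a b
    using sd_part_sym[OF R] sd_part_sym[OF Q] by (simp add: K_def sd_quadratic_def algebra_simps)
  with k11 k12 k13 k22 k23 k33 have "\<forall>a b. K a b = 0"
    unfolding forall_3 by metis
  then show ?thesis by (simp add: K_def)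
qed

text \<open>The system says that the endomorphism of the bivector \<open>v\<close> annihilates \<open>w\<close>; its square is
  multiplication by the quadratic form of \<open>v\<close>, up to sign.\<close>

lemma split_quaternion_kernel:
  fixes v1 v2 v3 w1 w2 w3 w4 :: real
  assumes "- (v3 * w1) - v2 * w2 + v1 * w3 = 0" "v2 * w1 - v3 * w2 + v1 * w4 = 0"
    "v1 * w1 - v3 * w3 + v2 * w4 = 0" "v1 * w2 - v2 * w3 - v3 * w4 = 0"
    and "- v1\<^sup>2 + v2\<^sup>2 + v3\<^sup>2 \<noteq> 0"
  shows "w1 = 0" "w2 = 0" "w3 = 0" "w4 = 0"
proof -
  let ?q = "- v1\<^sup>2 + v2\<^sup>2 + v3\<^sup>2"
  have "?q * w1 = 0" using assms(1-4) by algebra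
  moreover have "?q * w2 = 0" using assms(1-4) by algebra
  moreover have "?q * w3 = 0" using assms(1-4) by algebra
  moreover have "?q * w4 = 0" using assms(1-4) by algebra
  ultimately show "w1 = 0" "w2 = 0" "w3 = 0" "w4 = 0" using assms(5) by simp_all
qed

text \<open>The hypotheses say that a symmetric matrix has a scalar adjugate (after lowering an index).\<close>

lemma scalar_adjugate:
  fixes a b c d e f s :: real
  assumes "d * f - e\<^sup>2 = s" "a * f - c\<^sup>2 = - s" "a * d - b\<^sup>2 = - s" "b * f = c * e" "b * e = c * d" "a * e = b * c"
  shows "s * b = 0" "s * c = 0" "s * e = 0" "s * (a + d) = 0" "s * (a + f) = 0"
proof -
  note ring = power2_eq_square algebra_simps
  have s1: "s = d * f - e\<^sup>2" and s2: "s = c\<^sup>2 - a * f" and s3: "s = b\<^sup>2 - a * d"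
    using assms(1-3) by simp_all
  have "s * b = c * (b * c - a * e) - a * (b * f - c * e)" by (simp add: s2 ring)
  then show "s * b = 0" by (simp add: assms)
  have "s * c = b * (b * c - a * e) + a * (b * e - c * d)" by (simp add: s3 ring)
  then show "s * c = 0" by (simp add: assms)
  have "s * e = f * (b * c - a * e) - c * (b * f - c * e)" by (simp add: s2 ring)
  then show "s * e = 0" by (simp add: assms)
  have "s * a + s * d = e * (b * c - a * e) - c * (b * e - c * d)"
    by (subst s1, subst s2) (simp add: ring)
  then show "s * (a + d) = 0" by (simp add: assms distrib_left)
  have "s * a + s * f = e * (b * c - a * e) + b * (b * f - c * e)"
    by (subst s1, subst s3) (simp add: ring)
  then show "s * (a + f) = 0" by (simp add: assms distrib_left)
qed

text \<open>At one point, \<open>p\<close> is \<open>\<rho>\<close> with an index lowered and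
  \<open>A m\<close> its covariant derivative along the frame vector m; the four Bianchi equations
  belong to the four triples of frame vectors. In the rank-one case a column of \<open>p\<close>
  replaces the vector v, which avoids a square root and a choice of sign.\<close>

lemma parallel_core:
  fixes p :: "3 \<Rightarrow> 3 \<Rightarrow> real" and A :: "4 \<Rightarrow> 3 \<Rightarrow> 3 \<Rightarrow> real"
  assumes sp: "\<And>a b. p a b = p b a" and sA: "\<And>m a b. A m a b = A m b a"
    and tr: "(\<Sum>a\<in>UNIV. sg3 a * p a a) = l" and l: "l \<noteq> 0"
    and trA: "\<And>m. (\<Sum>a\<in>UNIV. sg3 a * A m a a) = 0"
    and E: "\<And>a b. sd_quadratic l l p p a b = 0"
    and E': "\<And>m a b. sd_quadratic l 0 p (A m) a b = 0"
    and bianchi: "\<And>b. - A 1 3 b - A 2 2 b + A 3 1 b = 0" "\<And>b. A 1 2 b - A 2 3 b + A 4 1 b = 0"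
      "\<And>b. A 1 1 b - A 3 3 b + A 4 2 b = 0" "\<And>b. A 2 1 b - A 3 2 b - A 4 3 b = 0"
  shows "A m a b = 0"
proof -
  note def = sd_quadratic_def sum_3
  have s: "p 2 1 = p 1 2" "p 3 1 = p 1 3" "p 3 2 = p 2 3" by (simp_all only: sp)
  have s': "A m 2 1 = A m 1 2" "A m 3 1 = A m 1 3" "A m 3 2 = A m 2 3" for m by (simp_all only: sA)
  \<comment> \<open>This is a third of the second elementary symmetric function, so that the
    adjugate of the endomorphism becomes exactly \<open>\<sigma>\<close>; \<open>\<sigma>'\<close>
    is its derivative.\<close>
  define \<sigma> where "\<sigma> = (l\<^sup>2 - (\<Sum>c\<in>UNIV. \<Sum>d\<in>UNIV. sg3 c * sg3 d * p c d * p c d)) / 6"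
  define \<sigma>' where "\<sigma>' m = - (\<Sum>c\<in>UNIV. \<Sum>d\<in>UNIV. sg3 c * sg3 d * p c d * A m c d) / 3" for m
  have \<sigma>: "6 * \<sigma> = l\<^sup>2 - ((p 1 1)\<^sup>2 + (p 2 2)\<^sup>2 + (p 3 3)\<^sup>2 - 2 * (p 1 2)\<^sup>2 - 2 * (p 1 3)\<^sup>2 + 2 * (p 2 3)\<^sup>2)"
    by (simp add: \<sigma>_def sum_3 s power2_eq_square)
  have tr': "l = - p 1 1 + p 2 2 + p 3 3" using tr by (simp add: sum_3)
  have q: "(\<Sum>c\<in>UNIV. sg3 c * p a c * p c b) = l * p a b - 2 * \<sigma> * (if a = b then sg3 a else 0)" for a b
  proof -
    have "(\<Sum>c\<in>UNIV. sg3 c * (p a c * p c b + p a c * p c b)) = 2 * (\<Sum>c\<in>UNIV. sg3 c * p a c * p c b)"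
      by (simp add: sum_distrib_left algebra_simps)
    moreover have "2 / 3 * (l * l - (\<Sum>c\<in>UNIV. \<Sum>d\<in>UNIV. sg3 c * sg3 d * p c d * p c d)) = 4 * \<sigma>"
      by (simp add: \<sigma>_def power2_eq_square)
    ultimately show ?thesis using E[of a b] unfolding sd_quadratic_def by (simp split: if_splits)
  qed
  have q': "(\<Sum>c\<in>UNIV. sg3 c * (p a c * A m c b + A m a c * p c b)) = l * A m a b - 2 * \<sigma>' m * (if a = b then sg3 a else 0)" for m a b
    using E'[of m a b] by (simp add: sd_quadratic_def \<sigma>'_def)
  note Q = q[of 1 1] q[of 2 2] q[of 3 3] q[of 1 2] q[of 1 3] q[of 2 3]
  \<comment> \<open>The cofactors of \<open>p\<close>. Lowering an index multiplies by diag(-1, 1,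
    1), whose adjugate diag(1, -1, -1) accounts for the signs.\<close>
  have min: "p 2 2 * p 3 3 - (p 2 3)\<^sup>2 = \<sigma>" "p 1 1 * p 3 3 - (p 1 3)\<^sup>2 = - \<sigma>" "p 1 1 * p 2 2 - (p 1 2)\<^sup>2 = - \<sigma>"
    "p 1 2 * p 3 3 = p 1 3 * p 2 3" "p 1 2 * p 2 3 = p 1 3 * p 2 2" "p 1 1 * p 2 3 = p 1 2 * p 1 3"
    using Q \<sigma> unfolding tr' by (simp_all add: sum_3 s power2_eq_square algebra_simps)
  show ?thesis
  proof (cases "\<sigma> = 0")
    case False
    have "\<sigma> * p 1 2 = 0" "\<sigma> * p 1 3 = 0" "\<sigma> * p 2 3 = 0" "\<sigma> * (p 1 1 + p 2 2) = 0" "\<sigma> * (p 1 1 + p 3 3) = 0"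
      using scalar_adjugate[OF min] by simp_all
    \<comment> \<open>Thus \<open>p\<close> is \<open>l / 3\<close> times diag(-1, 1, 1). Its
      contraction with the trace-free \<open>A m\<close> vanishes, and the differentiated identity
      reduces to \<open>2 * l / 3\<close> times \<open>A m\<close> being \<open>l\<close> times
      \<open>A m\<close>.\<close>
    then have z: "p 1 2 = 0" "p 1 3 = 0" "p 2 3 = 0" "p 2 2 = - p 1 1" "p 3 3 = - p 1 1"
      using False by auto
    then have l': "l = - 3 * p 1 1" "p 1 1 \<noteq> 0" using tr' l by auto
    have a: "- A m 1 1 + A m 2 2 + A m 3 3 = 0" using trA[of m] by (simp add: sum_3)
    have sm: "\<sigma>' m = 0" using a by (simp add: \<sigma>'_def sum_3 s z, algebra)
    then have "\<forall>a b. A m a b = 0"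
      using q'[where m = m and a = 1 and b = 1] q'[where m = m and a = 2 and b = 2] q'[where m = m and a = 3 and b = 3] q'[where m = m and a = 1 and b = 2] q'[where m = m and a = 1 and b = 3] q'[where m = m and a = 2 and b = 3] l'(2)
      by (simp add: sm forall_3 sum_3 s s' z l'(1) algebra_simps)
    then show ?thesis by blast
  next
    case True
    have rank1: "p a a * p b d = p b a * p a d" for a b d
    proof -
      have "\<forall>a b d. p a a * p b d = p b a * p a d"
        using min unfolding True forall_3 s by (simp add: power2_eq_square mult_ac)
      then show ?thesis by blast
    qed
    \<comment> \<open>The composite of \<open>\<rho>\<close> with its derivative. As
      \<open>p\<close> has rank one, every \<open>U m\<close> has its first index along a fixed
      vector.\<close>
    define U where "U m b c = (\<Sum>d\<in>UNIV. sg3 d * p b d * A m d c)" for m b c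
    \<comment> \<open>Contracting the differentiated identity with \<open>p\<close> and using that
      \<open>\<rho>\<close> squared is \<open>l\<close> times \<open>\<rho>\<close> gives
      \<open>2 * l * T = l * T - 2 * l * \<sigma>' m\<close> for the contraction T of
      \<open>p\<close> with \<open>A m\<close>, while \<open>T = - 3 * \<sigma>' m\<close>.\<close>
    have "l * \<sigma>' m = 0" for m
    proof -
      let ?T = "\<Sum>a\<in>UNIV. \<Sum>b\<in>UNIV. sg3 a * sg3 b * p a b * A m a b"
      have "(\<Sum>a\<in>UNIV. \<Sum>b\<in>UNIV. sg3 a * sg3 b * p a b * (\<Sum>c\<in>UNIV. sg3 c * (p a c * A m c b + A m a c * p c b))) =
        2 * (\<Sum>a\<in>UNIV. \<Sum>b\<in>UNIV. sg3 a * sg3 b * (\<Sum>c\<in>UNIV. sg3 c * p a c * p c b) * A m a b)"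
        by (simp add: sum_3 s s' algebra_simps)
      also have "\<dots> = 2 * l * ?T"
        unfolding q True by (simp add: sum_3 algebra_simps)
      also have "(\<Sum>a\<in>UNIV. \<Sum>b\<in>UNIV. sg3 a * sg3 b * p a b * (\<Sum>c\<in>UNIV. sg3 c * (p a c * A m c b + A m a c * p c b)))
          = l * ?T - 2 * \<sigma>' m * l"
        unfolding q' tr' by (simp add: sum_3 algebra_simps)
      finally show ?thesis by (simp add: \<sigma>'_def)
    qed
    then have \<sigma>'0: "\<sigma>' m = 0" for m using l by simp
    have UA: "U m b c + U m c b = l * A m b c" for m b c
      using q'[where m = m and a = b and b = c] sp[of _ c] sA[of m _ b] unfolding \<sigma>'0 U_def by (simp add: sum.distrib algebra_simps)
    \<comment> \<open>Contracting the free index of the Bianchi equations with \<open>p\<close>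
      gives them for the second index of \<open>U\<close>. Since \<open>l\<close> times
      \<open>A\<close> is \<open>U\<close> plus its transpose, they hold for the first index as
      well.\<close>
    have Ub: "- U 1 3 c - U 2 2 c + U 3 1 c = 0" "U 1 2 c - U 2 3 c + U 4 1 c = 0"
      "U 1 1 c - U 3 3 c + U 4 2 c = 0" "U 2 1 c - U 3 2 c - U 4 3 c = 0" for c
    proof -
      have z: "(\<Sum>d\<in>UNIV. sg3 d * p c d * (- A 1 3 d - A 2 2 d + A 3 1 d)) = 0"
        "(\<Sum>d\<in>UNIV. sg3 d * p c d * (A 1 2 d - A 2 3 d + A 4 1 d)) = 0"
        "(\<Sum>d\<in>UNIV. sg3 d * p c d * (A 1 1 d - A 3 3 d + A 4 2 d)) = 0"
        "(\<Sum>d\<in>UNIV. sg3 d * p c d * (A 2 1 d - A 3 2 d - A 4 3 d)) = 0"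
        by (simp_all only: bianchi mult_zero_right sum.neutral_const)
      have f: "U m c b = (\<Sum>d\<in>UNIV. sg3 d * p c d * A m b d)" for m b
        unfolding U_def sA[of m b] ..
      have "- U 1 c 3 - U 2 c 2 + U 3 c 1 = 0" "U 1 c 2 - U 2 c 3 + U 4 c 1 = 0"
        "U 1 c 1 - U 3 c 3 + U 4 c 2 = 0" "U 2 c 1 - U 3 c 2 - U 4 c 3 = 0"
        using z unfolding f by (simp_all add: sum_3 algebra_simps)
      moreover note UA[of 1 3 c] UA[of 2 2 c] UA[of 3 1 c] UA[of 1 2 c] UA[of 2 3 c] UA[of 4 1 c]
        UA[of 1 1 c] UA[of 3 3 c] UA[of 4 2 c] UA[of 2 1 c] UA[of 3 2 c] UA[of 4 3 c]
      moreover have "l * (- A 1 3 c - A 2 2 c + A 3 1 c) = 0" "l * (A 1 2 c - A 2 3 c + A 4 1 c) = 0"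
        "l * (A 1 1 c - A 3 3 c + A 4 2 c) = 0" "l * (A 2 1 c - A 3 2 c - A 4 3 c) = 0"
        by (simp_all only: bianchi mult_zero_right)
      ultimately show "- U 1 3 c - U 2 2 c + U 3 1 c = 0" "U 1 2 c - U 2 3 c + U 4 1 c = 0"
        "U 1 1 c - U 3 3 c + U 4 2 c = 0" "U 2 1 c - U 3 2 c - U 4 3 c = 0"
        by (simp_all add: algebra_simps)
    qed
    have Up: "p a a * U m b c = p b a * U m a c" for m a b c
      unfolding U_def sum_distrib_left using rank1[of a b] by (intro sum.cong refl) (simp add: algebra_simps)
    \<comment> \<open>Take the column \<open>a\<close> of \<open>p\<close> for v and
      \<open>U m a c\<close> for the components of w. Multiplied by \<open>p a a\<close>, the
      equations \<open>Ub\<close> become the system of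
      \<open>split_quaternion_kernel\<close>.\<close>
    have Uz: "p a a * U m a c = 0" for m a c
    proof (cases "p a a = 0")
      case False
      have v: "p 1 a * U m a c = p a a * U m 1 c" "p 2 a * U m a c = p a a * U m 2 c"
        "p 3 a * U m a c = p a a * U m 3 c" for m
        by (rule Up[symmetric])+
      \<comment> \<open>The diagonal entry of the quadratic identity: the column is non-null because
        both \<open>l\<close> and \<open>p a a\<close> are nonzero.\<close>
      have "- (p 1 a)\<^sup>2 + (p 2 a)\<^sup>2 + (p 3 a)\<^sup>2 = l * p a a"
        using q[of a a] by (simp add: sum_3 True power2_eq_square sp[of a 1] sp[of a 2] sp[of a 3])
      with False l have ne: "- (p 1 a)\<^sup>2 + (p 2 a)\<^sup>2 + (p 3 a)\<^sup>2 \<noteq> 0" by simp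
      have e: "p a a * (- U 1 3 c - U 2 2 c + U 3 1 c) = 0" "p a a * (U 1 2 c - U 2 3 c + U 4 1 c) = 0"
        "p a a * (U 1 1 c - U 3 3 c + U 4 2 c) = 0" "p a a * (U 2 1 c - U 3 2 c - U 4 3 c) = 0"
        by (simp_all only: Ub mult_zero_right)
      note e' = e[unfolded distrib_left right_diff_distrib mult_minus_right]
      have "U 1 a c = 0" "U 2 a c = 0" "U 3 a c = 0" "U 4 a c = 0"
        by (rule split_quaternion_kernel[OF _ _ _ _ ne, of "U 1 a c" "U 2 a c" "U 3 a c" "U 4 a c"];
            use e' v[of 1] v[of 2] v[of 3] v[of 4] in linarith)+
      then have "\<forall>m. U m a c = 0" unfolding forall_4 by simp
      then show ?thesis by simp
    qed simp
    have pU: "p a a * U m b c = 0" for m a b c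
      using Up[of a m b c] Uz[of a m c] by (cases "p a a = 0") auto
    \<comment> \<open>Some diagonal entry of \<open>p\<close> is nonzero, since the trace
      \<open>l\<close> is.\<close>
    have "U m b c = 0" for m b c
      using pU[of 1 m b c] pU[of 2 m b c] pU[of 3 m b c] tr' l by auto
    then show ?thesis using UA[of m a b] l by simp
  qed
qed

section \<open>Reversal of orientation\<close>

definition swap34 :: "4 \<Rightarrow> 4" where "swap34 i = (if i = 3 then 4 else if i = 4 then 3 else i)"

lemma swap34_simps [simp]: "swap34 1 = 1" "swap34 2 = 2" "swap34 3 = 4" "swap34 4 = 3"
  by (simp_all add: swap34_def)

lemma swap34_swap34 [simp]: "swap34 (swap34 i) = i"
  by (simp add: swap34_def)

lemma sg_swap34 [simp]: "sg (swap34 i) = sg i"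
  using exhaust_4[of i] by auto

lemma swap34_eq_iff [simp]: "swap34 i = swap34 j \<longleftrightarrow> i = j"
  by (metis swap34_swap34)

lemma sum_swap34: "(\<Sum>x\<in>UNIV. f (swap34 x)) = (\<Sum>x\<in>UNIV. f x)"
  for f :: "4 \<Rightarrow> real"
  by (simp add: sum_4)

definition reorient :: "(4 \<Rightarrow> 4 \<Rightarrow> 4 \<Rightarrow> 4 \<Rightarrow> real) \<Rightarrow> 4 \<Rightarrow> 4 \<Rightarrow> 4 \<Rightarrow> 4 \<Rightarrow> real" where
  "reorient R i j k m = R (swap34 i) (swap34 j) (swap34 k) (swap34 m)"

lemma curv_array_reorient:
  assumes "curv_array l R"
  shows "curv_array l (reorient R)"
proof -
  have R: "R i j k m = - R j i k m" "R i j k m = - R i j m k" "R i j k m + R j k i m + R k i j m = 0"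
    "(\<Sum>k\<in>UNIV. sg k * R k i j k) = (if i = j then l * sg i else 0)" for i j k m
    using assms unfolding curv_array_def by blast+
  have s: "(\<Sum>k\<in>UNIV. sg k * reorient R k i j k) = (if i = j then l * sg i else 0)" for i j
  proof -
    have "(\<Sum>k\<in>UNIV. sg k * reorient R k i j k) =
        (\<Sum>k\<in>UNIV. sg (swap34 k) * R (swap34 k) (swap34 i) (swap34 j) (swap34 k))"
      by (simp only: reorient_def sg_swap34)
    also have "\<dots> = (\<Sum>k\<in>UNIV. sg k * R k (swap34 i) (swap34 j) k)"
      by (rule sum_swap34)
    also have "\<dots> = (if i = j then l * sg i else 0)"
      by (simp only: R(4) sg_swap34 swap34_eq_iff)
    finally show ?thesis .
  qed
  have a: "reorient R i j k m = - reorient R j i k m" "reorient R i j k m = - reorient R i j m k"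
    "reorient R i j k m + reorient R j k i m + reorient R k i j m = 0" for i j k m
    unfolding reorient_def by (rule R)+
  show ?thesis
    unfolding curv_array_def by (intro conjI allI) (rule a s)+
qed

lemma curv_act_reorient:
  "curv_act (reorient Q) (reorient R) i j k l m n =
    curv_act Q R (swap34 i) (swap34 j) (swap34 k) (swap34 l) (swap34 m) (swap34 n)"
proof -
  define f where "f x = sg x * (R (swap34 k) (swap34 l) (swap34 m) x * Q (swap34 i) (swap34 j) x (swap34 n)
     - Q (swap34 i) (swap34 j) (swap34 m) x * R (swap34 k) (swap34 l) x (swap34 n)
     - Q (swap34 i) (swap34 j) (swap34 k) x * R x (swap34 l) (swap34 m) (swap34 n)
     - Q (swap34 i) (swap34 j) (swap34 l) x * R (swap34 k) x (swap34 m) (swap34 n))" for x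
  show ?thesis
    using sum_swap34[of f] by (simp add: curv_act_def reorient_def f_def)
qed

lemma sd_form_zero:
  assumes R: "curv_array l R" and z: "\<And>a b. sd_part R a b = 0"
  shows "sd_form R a i j = 0"
proof -
  have "sd_form R a i i = 0" "sd_form R a 2 1 = - sd_form R a 1 2" "sd_form R a 3 1 = - sd_form R a 1 3"
    "sd_form R a 4 1 = - sd_form R a 1 4" "sd_form R a 3 2 = - sd_form R a 2 3"
    "sd_form R a 4 2 = - sd_form R a 2 4" "sd_form R a 4 3 = - sd_form R a 3 4" for a i
    by (simp_all add: sd_form_def curv_array_antisym[OF R])
  then have "\<forall>i j. sd_form R a i j = 0"
    unfolding forall_4 using sd_form_eq_sd_part[OF R, of a] sd_part_simps[of R a] z by simp
  then show ?thesis by blast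
qed

text \<open>The self-dual combinations of \<open>R\<close> and of \<open>reorient R\<close> give,
  for each of the pairs 12 and 34, 13 and 24, 14 and 23, both the sum and the difference of
  components.\<close>

lemma curv_array_zero:
  assumes R: "curv_array l R" and z: "\<And>a b. sd_part R a b = 0" "\<And>a b. sd_part (reorient R) a b = 0"
  shows "R i j k m = 0"
proof -
  note f = sd_form_zero[OF R z(1)]
  have g: "sd_form (reorient R) a (swap34 k) (swap34 m) = 0" for a
    by (rule sd_form_zero[OF curv_array_reorient[OF R] z(2)])
  note g' = g[of 1] g[of 2] g[of 3]
  note fg = f[of 1 k m] f[of 2 k m] f[of 3 k m] g'
  have "R 1 2 k m = 0" "R 3 4 k m = 0" "R 1 3 k m = 0" "R 2 4 k m = 0" "R 1 4 k m = 0" "R 2 3 k m = 0"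
    using fg by (simp_all add: sd_form_simps reorient_def curv_array_antisym[OF R])
  then have "\<forall>i j. R i j k m = 0"
    unfolding forall_4 by (simp add: curv_array_antisym[OF R])
  then show ?thesis by blast
qed

lemma sd_part_parallel:
  assumes R: "curv_array l R" and l: "l \<noteq> 0" and Q: "\<And>h. curv_array 0 (Q h)"
    and semi: "\<And>i j k m n p. curv_act R R i j k m n p = 0"
    and semi': "\<And>h i j k m n p. curv_act (Q h) R i j k m n p + curv_act R (Q h) i j k m n p = 0"
    and bianchi: "\<And>h i j k m. Q h i j k m + Q i j h k m + Q j h i k m = 0"
  shows "sd_part (Q h) a b = 0"
proof (rule parallel_core[where A = "\<lambda>h. sd_part (Q h)" and p = "sd_part R" and l = l])
  show "sd_part R a b = sd_part R b a" for a b by (rule sd_part_sym[OF R])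
  show "sd_part (Q h) a b = sd_part (Q h) b a" for h a b by (rule sd_part_sym[OF Q])
  show "(\<Sum>a\<in>UNIV. sg3 a * sd_part R a a) = l" by (rule sd_part_trace[OF R])
  show "(\<Sum>a\<in>UNIV. sg3 a * sd_part (Q h) a a) = 0" for h by (rule sd_part_trace[OF Q])
  show "sd_quadratic l l (sd_part R) (sd_part R) a b = 0" for a b
    by (rule sd_quadratic_zero[OF R R]) (simp add: semi)
  show "sd_quadratic l 0 (sd_part R) (sd_part (Q h)) a b = 0" for h a b
    by (rule sd_quadratic_zero[OF R Q semi'])
  \<comment> \<open>Pair symmetry moves the cyclic sum of the second Bianchi identity to the last
    two indices, leaving the first pair free to be made self-dual.\<close>
  have c: "Q h k m i j + Q i k m j h + Q j k m h i = 0" for h i j k m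
    unfolding curv_array_pair[OF Q, of _ k m] by (rule bianchi)
  have F: "sd_form (Q h) b i j + sd_form (Q i) b j h + sd_form (Q j) b h i = 0" for b h i j
    using c[of h 1 2 i j] c[of h 3 4 i j] c[of h 1 3 i j] c[of h 2 4 i j] c[of h 1 4 i j] c[of h 2 3 i j]
    unfolding sd_form_def by (simp split: if_splits)
  have anti: "sd_form (Q h) b i j = - sd_form (Q h) b j i" for h b i j
  proof -
    have "Q h k m i j = - Q h k m j i" for k m
      using Q[of h] unfolding curv_array_def by blast
    from this[of 1 2] this[of 3 4] this[of 1 3] this[of 2 4] this[of 1 4] this[of 2 3] show ?thesis
      unfolding sd_form_def by (simp split: if_splits)
  qed
  note sd = sd_form_eq_sd_part[OF Q] sd_part_simps[symmetric]
  have s: "sd_part (Q h) b a = sd_part (Q h) a b" for h a b by (rule sd_part_sym[OF Q])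
  \<comment> \<open>The triple 1, 2, 3 of frame vectors; the next three equations use 124, 134 and
    234. Self-duality of the form turns each component into an entry of
    \<open>sd_part\<close>.\<close>
  show "- sd_part (Q 1) 3 b - sd_part (Q 2) 2 b + sd_part (Q 3) 1 b = 0" for b
    using F[of 1 b 2 3] anti[of 2 b 3 1] by (simp add: sd s[of _ b 1] s[of _ b 2] s[of _ b 3])
  show "sd_part (Q 1) 2 b - sd_part (Q 2) 3 b + sd_part (Q 4) 1 b = 0" for b
    using F[of 1 b 2 4] anti[of 2 b 4 1] by (simp add: sd s[of _ b 1] s[of _ b 2] s[of _ b 3])
  show "sd_part (Q 1) 1 b - sd_part (Q 3) 3 b + sd_part (Q 4) 2 b = 0" for b
    using F[of 1 b 3 4] anti[of 3 b 4 1] by (simp add: sd s[of _ b 1] s[of _ b 2] s[of _ b 3])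
  show "sd_part (Q 2) 1 b - sd_part (Q 3) 2 b - sd_part (Q 4) 3 b = 0" for b
    using F[of 2 b 3 4] anti[of 3 b 4 2] by (simp add: sd s[of _ b 1] s[of _ b 2] s[of _ b 3])
qed (rule l)

text \<open>Swapping two basis vectors of the same sign exchanges self-dual and anti-self-dual parts.\<close>

lemma curv_array_parallel:
  assumes R: "curv_array l R" and l: "l \<noteq> 0" and Q: "\<And>h. curv_array 0 (Q h)"
    and semi: "\<And>i j k m n p. curv_act R R i j k m n p = 0"
    and semi': "\<And>h i j k m n p. curv_act (Q h) R i j k m n p + curv_act R (Q h) i j k m n p = 0"
    and bianchi: "\<And>h i j k m. Q h i j k m + Q i j h k m + Q j h i k m = 0"
  shows "Q h i j k m = 0"
proof (rule curv_array_zero[OF Q])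
  show "sd_part (Q h) a b = 0" for a b
    by (rule sd_part_parallel[OF assms])
  \<comment> \<open>The direction of differentiation must be relabelled together with the other
    indices to keep the second Bianchi identity. The double swap undoes this relabelling in the
    conclusion.\<close>
  have "sd_part (reorient (Q (swap34 (swap34 h)))) a b = 0" for a b
  proof (rule sd_part_parallel[where Q = "\<lambda>h. reorient (Q (swap34 h))" and R = "reorient R", OF _ l])
    show "reorient (Q (swap34 h)) i j k m + reorient (Q (swap34 i)) j h k m + reorient (Q (swap34 j)) h i k m = 0"
      for h i j k m
      unfolding reorient_def by (rule bianchi)
    show "curv_act (reorient R) (reorient R) i j k m n p = 0" for i j k m n p
      unfolding curv_act_reorient by (rule semi)
    show "curv_act (reorient (Q (swap34 h))) (reorient R) i j k m n p +
        curv_act (reorient R) (reorient (Q (swap34 h))) i j k m n p = 0" for h i j k m n p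
      unfolding curv_act_reorient by (rule semi')
  qed (rule curv_array_reorient[OF R] curv_array_reorient[OF Q])+
  then show "sd_part (reorient (Q h)) a b = 0" for a b by simp
qed

section \<open>Neutral Einstein metrics\<close>

lemma neutral_frame_exists:
  fixes B :: "real ^ 4 ^ 4"
  assumes "has_signature B 2 2"
  obtains e :: "4 \<Rightarrow> real ^ 4" where "\<And>i j. bilin B (e i) (e j) = (if i = j then sg i else 0)"
proof -
  from assms[unfolded has_signature_def, THEN conjunct2] obtain e :: "4 \<Rightarrow> real ^ 4"
    where "(\<forall>i j. i \<noteq> j \<longrightarrow> bilin B (e i) (e j) = 0) \<and>
      (\<forall>i. bilin B (e i) (e i) = 1 \<or> bilin B (e i) (e i) = -1) \<and>
      card {i. bilin B (e i) (e i) = 1} = 2 \<and> card {i. bilin B (e i) (e i) = -1} = 2"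
    by (rule exE)
  then have o: "i \<noteq> j \<Longrightarrow> bilin B (e i) (e j) = 0"
    and c: "card {i. bilin B (e i) (e i) = 1} = 2" "card {i. bilin B (e i) (e i) = -1} = 2" for i j
    by simp_all
  obtain a b where ab: "{i. bilin B (e i) (e i) = 1} = {a, b}" "a \<noteq> b"
    using c(1)[unfolded card_2_iff] by blast
  obtain c d where cd: "{i. bilin B (e i) (e i) = -1} = {c, d}" "c \<noteq> d"
    using c(2)[unfolded card_2_iff] by blast
  define f where "f i = (if i = 1 then a else if i = 2 then b else if i = 3 then c else d)" for i :: 4
  have n: "bilin B (e a) (e a) = 1" "bilin B (e b) (e b) = 1" "bilin B (e c) (e c) = -1" "bilin B (e d) (e d) = -1"
    using equalityD2[OF ab(1)] equalityD2[OF cd(1)] by simp_all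
  have f: "f 1 = a" "f 2 = b" "f 3 = c" "f 4 = d"
    by (simp_all add: f_def)
  have "a \<noteq> c" "a \<noteq> d" "b \<noteq> c" "b \<noteq> d"
    using n by auto
  then have frame: "\<forall>i j. bilin B (e (f i)) (e (f j)) = (if i = j then sg i else 0)"
    unfolding forall_4 using ab(2) cd(2) n by (simp add: f o)
  show thesis
    by (rule that[of "\<lambda>i. e (f i)"]) (rule frame[rule_format])
qed

text \<open>Orthonormality says that the matrix of dual covectors is a left inverse of the frame
  matrix; for square matrices it is then a right inverse, which is the expansion.\<close>

lemma frame_expansion:
  fixes B :: "real ^ 4 ^ 4" and e :: "4 \<Rightarrow> real ^ 4"
  assumes e: "\<And>i j. bilin B (e i) (e j) = (if i = j then sg i else 0)"
  shows "u = (\<Sum>i\<in>UNIV. (sg i * bilin B u (e i)) *\<^sub>R e i)"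
proof -
  define P where "P = (\<chi> j i. e i $ j)"
  define W where "W = (\<chi> i. \<chi> j. sg i * (B *v e i) $ j)"
  have sg2: "sg i * sg i = 1" for i by (simp add: sg_def)
  have Wv: "(W *v v) $ i = sg i * bilin B v (e i)" for v i
    by (simp add: W_def bilin_def matrix_vector_mult_def inner_vec_def sum_distrib_left mult_ac)
  have "(W ** P) $ i $ j = (W *v e j) $ i" for i j
    by (simp add: P_def matrix_matrix_mult_def matrix_vector_mult_def)
  then have "W ** P = mat 1"
    by (simp add: vec_eq_iff Wv e mat_def sg2)
  then have "P ** W = mat 1" by (rule matrix_left_right_inverse[THEN iffD1])
  then have "u = P *v (W *v u)" by (simp add: matrix_vector_mul_assoc)
  moreover have "P *v v = (\<Sum>i\<in>UNIV. v $ i *\<^sub>R e i)" for v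
    by (simp add: vec_eq_iff matrix_vector_mult_def P_def mult.commute)
  ultimately show ?thesis by (simp add: Wv)
qed

text \<open>Independence of the trace from the basis; it turns the coordinate trace defining the
  Ricci tensor into the signed sum in \<open>curv_array\<close>.\<close>

lemma frame_trace:
  fixes B :: "real ^ 4 ^ 4" and e :: "4 \<Rightarrow> real ^ 4"
  assumes e: "\<And>i j. bilin B (e i) (e j) = (if i = j then sg i else 0)"
    and T: "linear T"
  shows "(\<Sum>k\<in>UNIV. T (axis k 1) $ k) = (\<Sum>i\<in>UNIV. sg i * bilin B (T (e i)) (e i))"
proof -
  define c where "c i u = sg i * bilin B u (e i)" for i u
  have x: "u = (\<Sum>i\<in>UNIV. c i u *\<^sub>R e i)" for u
    unfolding c_def by (rule frame_expansion[OF e])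
  have c: "linear (c i)" for i
    unfolding c_def by (intro linearI) (simp_all add: bilin_add_left bilin_scaleR_left algebra_simps)
  have "(\<Sum>k\<in>UNIV. T (axis k 1) $ k) = (\<Sum>k\<in>UNIV. \<Sum>i\<in>UNIV. c i (T (axis k 1)) * e i $ k)"
    by (subst x[of "T _"]) simp
  also have "\<dots> = (\<Sum>i\<in>UNIV. \<Sum>k\<in>UNIV. e i $ k *\<^sub>R c i (T (axis k 1)))"
    by (subst sum.swap) (simp add: mult.commute)
  also have "\<dots> = (\<Sum>i\<in>UNIV. c i (T (e i)))"
    using linear_axis_expansion[OF linear_compose[OF T c], symmetric] by (simp add: o_def)
  finally show ?thesis by (simp add: c_def)
qed

text \<open>Covers the components of both \<open>R\<close> and \<open>\<nabla>R\<close>, whose Ricci tensors are \<open>l g\<close> and \<open>0\<close>.\<close>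

lemma curv_array_components:
  fixes B :: "real ^ 4 ^ 4" and e :: "4 \<Rightarrow> real ^ 4" and T :: "real ^ 4 \<Rightarrow> real ^ 4 \<Rightarrow> real ^ 4 \<Rightarrow> real ^ 4"
  assumes e: "\<And>i j. bilin B (e i) (e j) = (if i = j then sg i else 0)"
    and sym: "\<And>u v. bilin B u v = bilin B v u"
    and lin: "\<And>b c. linear (\<lambda>a. T a b c)"
    and skew: "\<And>a b c. T a b c = - T b a c" and metric: "\<And>a b c d. bilin B (T a b c) d = - bilin B c (T a b d)"
    and bianchi: "\<And>a b c. T a b c + T b c a + T c a b = 0"
    and trace: "\<And>u w. (\<Sum>k\<in>UNIV. T (axis k 1) u w $ k) = l * bilin B u w"
  shows "curv_array l (\<lambda>i j k m. bilin B (T (e i) (e j) (e k)) (e m))"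
  unfolding curv_array_def
proof (intro conjI allI)
  fix i j k m
  have neg: "bilin B (- u) v = - bilin B u v" for u v
    using bilin_scaleR_left[of B "-1" u v] by simp
  show "bilin B (T (e i) (e j) (e k)) (e m) = - bilin B (T (e j) (e i) (e k)) (e m)"
    by (subst skew) (rule neg)
  show "bilin B (T (e i) (e j) (e k)) (e m) = - bilin B (T (e i) (e j) (e m)) (e k)"
    by (subst metric, subst sym) (rule refl)
  show "bilin B (T (e i) (e j) (e k)) (e m) + bilin B (T (e j) (e k) (e i)) (e m)
      + bilin B (T (e k) (e i) (e j)) (e m) = 0"
    unfolding bilin_add_left[symmetric] bianchi by (simp add: bilin_def)
  show "(\<Sum>k\<in>UNIV. sg k * bilin B (T (e k) (e i) (e j)) (e k)) = (if i = j then l * sg i else 0)"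
    using frame_trace[OF e lin, of "e i" "e j"] by (cases "i = j") (simp_all add: trace e)
qed

text \<open>Each sum over \<open>x\<close> in \<open>curv_act\<close> is the frame expansion of an
  inner vector pulled through an outer linear map.\<close>

lemma curv_act_components:
  fixes B :: "real ^ 4 ^ 4" and e :: "4 \<Rightarrow> real ^ 4" and T U :: "real ^ 4 \<Rightarrow> real ^ 4 \<Rightarrow> real ^ 4 \<Rightarrow> real ^ 4"
  assumes e: "\<And>i j. bilin B (e i) (e j) = (if i = j then sg i else 0)"
    and T: "\<And>a b. linear (T a b)"
    and U: "\<And>b c. linear (\<lambda>a. U a b c)" "\<And>a c. linear (\<lambda>b. U a b c)" "\<And>a b. linear (U a b)"
  shows "curv_act (\<lambda>i j k m. bilin B (T (e i) (e j) (e k)) (e m)) (\<lambda>i j k m. bilin B (U (e i) (e j) (e k)) (e m))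
      i j k l m n =
    bilin B (T (e i) (e j) (U (e k) (e l) (e m)) - U (e k) (e l) (T (e i) (e j) (e m))
      - U (T (e i) (e j) (e k)) (e l) (e m) - U (e k) (T (e i) (e j) (e l)) (e m)) (e n)"
proof -
  have x: "bilin B (f u) (e n) = (\<Sum>x\<in>UNIV. sg x * (bilin B u (e x) * bilin B (f (e x)) (e n)))"
    if f: "linear f" for f :: "real ^ 4 \<Rightarrow> real ^ 4" and u
  proof -
    have "f u = (\<Sum>i\<in>UNIV. (sg i * bilin B u (e i)) *\<^sub>R f (e i))"
      by (subst frame_expansion[OF e, of u]) (simp add: linear_sum[OF f] linear_scale[OF f])
    then show ?thesis
      by (simp add: linear_sum[OF linear_bilin_left] bilin_scaleR_left mult.assoc)
  qed
  show ?thesis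
    unfolding curv_act_def bilin_diff_left x[OF T, where u = "U (e k) (e l) (e m)"]
      x[OF U(3), where u = "T (e i) (e j) (e m)"] x[OF U(1), where u = "T (e i) (e j) (e k)"]
      x[OF U(2), where u = "T (e i) (e j) (e l)"]
    by (simp add: sum_subtractf right_diff_distrib)
qed

text \<open>A frame at the single point \<open>x\<close> suffices: the differentiation has been
  carried out on constant coordinate fields, and the resulting identities are multilinear in vectors
  at \<open>x\<close>.\<close>

lemma einstein_semi_symmetric_parallel:
  fixes G :: "real ^ 4 \<Rightarrow> real ^ 4 ^ 4"
  assumes "metric_chart S G" and x: "x \<in> S" and sig: "has_signature (G x) 2 2"
    and ein: "\<And>y. y \<in> S \<Longrightarrow> ricci_operator G y = mat r" and r: "r \<noteq> 0"
    and semi: "\<And>y. y \<in> S \<Longrightarrow> metric_chart.semi_symmetric_at G y"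
  shows "nabla_curv_tensor G x v a b c = 0"
proof -
  interpret metric_chart S G by fact
  let ?B = "bilin (G x)"
  obtain e :: "4 \<Rightarrow> real ^ 4" where e: "\<And>i j. ?B (e i) (e j) = (if i = j then sg i else 0)"
    using neutral_frame_exists[OF sig] by blast
  note sym = \<beta>_sym[OF x]
  define R where "R i j k m = ?B (Rm x (e i) (e j) (e k)) (e m)" for i j k m
  define Q where "Q h i j k m = ?B (nR x (e h) (e i) (e j) (e k)) (e m)" for h i j k m
  note lR = linear_Rm1[OF x] linear_Rm2[OF x] linear_Rm3[OF x]
  note lQ = linear_nR1[OF x] linear_nR2[OF x] linear_nR3[OF x]
  have cR: "curv_array r R"
    unfolding R_def[abs_def]
    by (rule curv_array_components[OF e sym lR(1) Rm_skew Rm_metric[OF x] Rm_bianchi[OF x] Rm_trace[OF x ein[OF x]]])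
  have cQ: "curv_array 0 (Q h)" for h
    unfolding Q_def[abs_def]
    by (rule curv_array_components[OF e sym lQ(1) nR_skew[OF x] nR_metric[OF x] nR_bianchi1[OF x]])
      (simp add: nR_trace[OF x ein])
  have s: "curv_act R R i j k m n p = 0" for i j k m n p
    unfolding R_def[abs_def] curv_act_components[where T = "Rm x" and U = "Rm x", OF e lR(3) lR]
    using semi[OF x] by (simp add: semi_symmetric_at_def bilin_def)
  \<comment> \<open>The eight terms of the differentiated identity split into the action of the
    derivative on \<open>R\<close> and the action of \<open>R\<close> on the derivative.\<close>
  have s': "curv_act (Q h) R i j k m n p + curv_act R (Q h) i j k m n p = 0" for h i j k m n p
    unfolding R_def[abs_def] Q_def[abs_def] 
      curv_act_components[where T = "nR x (e h)" and U = "Rm x", OF e lQ(3) lR]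
      curv_act_components[where T = "Rm x" and U = "nR x (e h)", OF e lR(3) lQ] bilin_add_left[symmetric]
    using semi_symmetric_derivative[OF semi x, of "e h" "e i" "e j" "e k" "e m" "e n"]
    by (simp add: bilin_def algebra_simps)
  have b: "Q h i j k m + Q i j h k m + Q j h i k m = 0" for h i j k m
    unfolding Q_def bilin_add_left[symmetric] nR_bianchi2[OF x] by (simp add: bilin_def)
  have Q: "Q h i j k m = 0" for h i j k m
    by (rule curv_array_parallel[where Q = Q, OF cR r cQ s s' b])
  have frame: "nR x (e h) (e i) (e j) (e k) = 0" for h i j k
    using frame_expansion[OF e, of "nR x (e h) (e i) (e j) (e k)"] Q[of h i j k] by (simp add: Q_def)
  have zero: "f u = 0" if "linear f" "\<And>i. f (e i) = 0" for f :: "real ^ 4 \<Rightarrow> real ^ 4" and u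
    by (subst frame_expansion[OF e, of u]) (simp add: linear_sum[OF that(1)] linear_scale[OF that(1)] that(2))
  show ?thesis
    by (rule zero[OF linear_nR0[OF x]], rule zero[OF lQ(1)], rule zero[OF lQ(2)], rule zero[OF lQ(3)])
      (rule frame)
qed

theorem theorem1p1:
  fixes M :: "'m topology"
    and A :: "('m, 4) chart set"
    and g :: "('m, 4) chart \<Rightarrow> real ^ 4 \<Rightarrow> real ^ 4 ^ 4"
  assumes "pseudo_riemannian_manifold M A g 2 2"
    and "einstein A g"
    and "\<forall>c\<in>A. \<forall>x\<in>chart_image c. scalar_curvature (g c) x \<noteq> 0"
  shows "semi_symmetric A g \<longleftrightarrow> locally_symmetric A g"
proof -
  have chart: "metric_chart (chart_image c) (g c)" if "c \<in> A" for c
  proof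
    show "open (chart_image c)" "smooth_on (chart_image c) (g c)"
      using assms(1) that
      unfolding pseudo_riemannian_manifold_def smooth_manifold_def pseudo_riemannian_metric_def by blast+
    fix x assume "x \<in> chart_image c"
    then have "has_signature (g c x) 2 2"
      using assms(1) that unfolding pseudo_riemannian_manifold_def pseudo_riemannian_metric_def by blast
    then show "transpose (g c x) = g c x" "invertible (g c x)"
      using has_signature_invertible by (auto simp: has_signature_def)
  qed
  have semi: "semi_symmetric A g \<longleftrightarrow>
      (\<forall>c\<in>A. \<forall>x\<in>chart_image c. metric_chart.semi_symmetric_at (g c) x)"
    unfolding semi_symmetric_def Let_def
    by (intro ball_cong refl metric_chart.semi_symmetric_iff[OF chart])
  have par: "locally_symmetric A g \<longleftrightarrow>
      (\<forall>c\<in>A. \<forall>x\<in>chart_image c. \<forall>v a b d. nabla_curv_tensor (g c) x v a b d = 0)"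
    unfolding locally_symmetric_def
    by (intro ball_cong refl metric_chart.locally_symmetric_iff[OF chart])
  obtain r where r: "\<And>c x. c \<in> A \<Longrightarrow> x \<in> chart_image c \<Longrightarrow> ricci_operator (g c) x = mat r"
    using assms(2) unfolding einstein_def by blast
  show ?thesis
  proof
    assume s: "semi_symmetric A g"
    show "locally_symmetric A g"
      unfolding par
    proof (intro ballI allI)
      fix c x v a b d assume c: "c \<in> A" and x: "x \<in> chart_image c"
      have "scalar_curvature (g c) x = trace (mat r :: real ^ 4 ^ 4)"
        by (simp add: scalar_curvature_def r[OF c x])
      \<comment> \<open>The trace of \<open>mat r\<close> is \<open>4 * r\<close>.\<close>
      then have nz: "r \<noteq> 0" using assms(3) c x by (auto simp: trace_def mat_def)
      have sig: "has_signature (g c x) 2 2"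
        using assms(1) c x unfolding pseudo_riemannian_manifold_def pseudo_riemannian_metric_def by blast
      have "metric_chart.semi_symmetric_at (g c) y" if "y \<in> chart_image c" for y
        using s c that unfolding semi by blast
      from einstein_semi_symmetric_parallel[OF chart[OF c] x sig r[OF c] nz this]
      show "nabla_curv_tensor (g c) x v a b d = 0" .
    qed
  next
    assume "locally_symmetric A g"
    then show "semi_symmetric A g"
      unfolding semi par using metric_chart.parallel_imp_semi_symmetric[OF chart] by blast
  qed
qed

end
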